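(* Let $G$ be an $\ell$-group, $D\subset\mathbb{C}$ an open subset, and $\varpi$ a $D$-holomorphic character of $G$. Let $V$ be a smooth representation of $G$, $W$ an admissible smooth representation of $G$, and $\xi$ a $\varpi$-equivariant meromorphic intertwining operator from $V$ to $W$ over $D$. Let $s_0\in D$ be such that $\varpi(s_0,g)=1$ for all $g\in G$, and let $U\subseteq V$ be a sub-representation such that $\xi|_U$ is holomorphic at $s_0$. Let $k_0$ be the order of the pole of $\xi(s)$ at $s=s_0$, and let $\delta:\mathrm{Hom}_G(U,W)\to\mathrm{Ext}^1_G(V/U,W)$ be the connecting homomorphism. Assume that $k_0\ge1$ and that there exist $g_1,g_2,\dots,g_{k_0}\in G$ such that (1) $\frac{d\varpi(s,g_i)}{ds}(s_0)\neq0$ for each $i$; (2) $(g_1-1)(g_2-1)\cdots(g_{k_0}-1)$ acts on $\mathrm{Hom}_{G,\infty}(V/U,W)$ by zero. Then $\delta(\xi|_U(s_0))\neq0$.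
   Context: An $\ell$-group is a topological group that is Hausdorff, locally compact, totally disconnected and second-countable. Representations are on complex vector spaces; a smooth representation is admissible if $W^K$ is finite dimensional for every compact open subgroup $K$. $\mathrm{Ext}^i_G$ denotes Ext in the category of smooth representations of $G$. $G$ acts on $\mathrm{Hom}(A,W)$ by $(g\cdot f)(a)=g f(g^{-1}a)$. A $D$-holomorphic character of $G$ is a map $\varpi:D\times G\to\mathbb{C}^\times$ such that $\varpi(\cdot,g)$ is holomorphic on $D$ for every $g\in G$, and there is an open subgroup $K\subset G$ such that for every $s\in D$, $\varpi(s,\cdot):G\to\mathbb{C}^\times$ is a group homomorphism with $K$ in its kernel. A $\varpi$-equivariant meromorphic intertwining operator from $V$ to $W$ over $D$ is a map $\xi:D\times V\to W$ (meromorphic in $s$, so defined for $s$ outside its poles), with $\xi(s)=\xi(s,\cdot)$, such that: (i) $g\cdot\xi(s,v)=\varpi(s,g)\,\xi(s,g\cdot v)$ for all $g\in G$, $v\in V$; (ii) $\xi(s,\cdot)$ is linear for each $s$, and for every $v\in V$ there is an open subgroup $K$ of $G$ stabilizing $v$ such that $\varpi$ is trivial on $K$ and $\xi(\cdot,v)$ is a meromorphic function on $D$ with values in the finite-dimensional space $W^K$; (iii) there is a discrete subset $\Pi\subset D$ such that $\xi(\cdot,v)$ is holomorphic outside $\Pi$ for every $v\in V$, and at each point of $\Pi$ the orders of the poles are bounded uniformly in $v\in V$. The Laurent expansion at $s_0$ is $\xi(s)=\sum_{i\ge -k_0}\xi_i(s-s_0)^i$ with $\xi_i\in\mathrm{Hom}(V,W)$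 and $\xi_{-k_0}\ne0$, $k_0$ being the order of the pole. For smooth representations $A,W$ of $G$ and $k\ge0$, $\mathrm{Hom}_{G,k}(A,W)$ is the space of $\eta\in\mathrm{Hom}(A,W)$ with $(g_0-1)(g_1-1)\cdots(g_k-1)\cdot\eta=0$ for all $g_0,\dots,g_k\in G$, and $\mathrm{Hom}_{G,\infty}(A,W)=\bigcup_{k\ge0}\mathrm{Hom}_{G,k}(A,W)$. The connecting map $\delta$ is the one in the long exact sequence $0\to\mathrm{Hom}_G(V/U,W)\to\mathrm{Hom}_G(V,W)\to\mathrm{Hom}_G(U,W)\xrightarrow{\delta}\mathrm{Ext}^1_G(V/U,W)\to\cdots$. *)

theory Defs
  imports
    "HOL-Complex_Analysis.Complex_Analysis"
    "HOL-Algebra.Algebraic_Closure_Type"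
begin

section \<open>Topological groups and smooth representations\<close>

locale l_group = group G
  for G :: "('g, 'm) monoid_scheme" (structure) and T :: "'g topology" +
  assumes topspace_eq: "topspace T = carrier G"
    and continuous_mult: "continuous_map (prod_topology T T) T (\<lambda>(x, y). x \<otimes> y)"
    and continuous_inv: "continuous_map T T (\<lambda>x. inv x)"
    and Hausdorff: "Hausdorff_space T"
    and locally_compact: "locally_compact_space T"
    and totally_disconnected: "\<And>S. connectedin T S \<Longrightarrow> \<exists>x. S \<subseteq> {x}"
    and second_countable:
      "\<exists>\<B>. countable \<B> \<and> openin T = arbitrary union_of (\<lambda>S. S \<in> \<B>)"

definition open_subgroup :: "('g, 'm) monoid_scheme \<Rightarrow> 'g topology \<Rightarrow> 'g set \<Rightarrow> bool" where
  "open_subgroup G T K \<longleftrightarrow> subgroup K G \<and> openin T K"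

abbreviation complex_field :: "complex ring" where
  "complex_field \<equiv> ring_of_type_algebra"

text \<open>
  The fields \<open>mult\<close> and \<open>one\<close> that the record \<open>module\<close> inherits from \<open>ring\<close> play no role
  for representations; they are left \<open>undefined\<close> in the constructions below.
\<close>

record ('g, 'v) rep = "(complex, 'v) module" +
  act :: "'g \<Rightarrow> 'v \<Rightarrow> 'v"

definition linear_map :: "('g, 'a) rep \<Rightarrow> ('g, 'b) rep \<Rightarrow> ('a \<Rightarrow> 'b) \<Rightarrow> bool" where
  "linear_map A B f \<longleftrightarrow>
     f \<in> carrier A \<rightarrow> carrier B \<and>
     (\<forall>x\<in>carrier A. \<forall>y\<in>carrier A. f (x \<oplus>\<^bsub>A\<^esub> y) = f x \<oplus>\<^bsub>B\<^esub> f y) \<and>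
     (\<forall>c. \<forall>x\<in>carrier A. f (c \<odot>\<^bsub>A\<^esub> x) = c \<odot>\<^bsub>B\<^esub> f x)"

definition intertwiner ::
    "('g, 'm) monoid_scheme \<Rightarrow> ('g, 'a) rep \<Rightarrow> ('g, 'b) rep \<Rightarrow> ('a \<Rightarrow> 'b) \<Rightarrow> bool" where
  "intertwiner G A B f \<longleftrightarrow>
     linear_map A B f \<and> (\<forall>g\<in>carrier G. \<forall>x\<in>carrier A. f (act A g x) = act B g (f x))"

definition group_rep :: "('g, 'm) monoid_scheme \<Rightarrow> ('g, 'v) rep \<Rightarrow> bool" where
  "group_rep G V \<longleftrightarrow>
     Module.module complex_field V \<and>
     (\<forall>g\<in>carrier G. linear_map V V (act V g)) \<and>
     (\<forall>v\<in>carrier V. act V \<one>\<^bsub>G\<^esub> v = v) \<and>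
     (\<forall>g\<in>carrier G. \<forall>h\<in>carrier G. \<forall>v\<in>carrier V. act V (g \<otimes>\<^bsub>G\<^esub> h) v = act V g (act V h v))"

definition smooth_rep ::
    "('g, 'm) monoid_scheme \<Rightarrow> 'g topology \<Rightarrow> ('g, 'v) rep \<Rightarrow> bool" where
  "smooth_rep G T V \<longleftrightarrow>
     group_rep G V \<and>
     (\<forall>v\<in>carrier V. \<exists>K. open_subgroup G T K \<and> (\<forall>k\<in>K. act V k v = v))"

definition fixed_vectors :: "('g, 'v) rep \<Rightarrow> 'g set \<Rightarrow> 'v set" where
  "fixed_vectors V K = {v \<in> carrier V. \<forall>k\<in>K. act V k v = v}"

definition lincomb :: "('g, 'v) rep \<Rightarrow> ('v \<Rightarrow> complex) \<Rightarrow> 'v set \<Rightarrow> 'v" where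
  "lincomb V c B = (\<Oplus>\<^bsub>V\<^esub>b\<in>B. c b \<odot>\<^bsub>V\<^esub> b)"

definition fin_dim :: "('g, 'v) rep \<Rightarrow> 'v set \<Rightarrow> bool" where
  "fin_dim V Z \<longleftrightarrow> (\<exists>B. finite B \<and> B \<subseteq> Z \<and> (\<forall>x\<in>Z. \<exists>c. x = lincomb V c B))"

definition admissible ::
    "('g, 'm) monoid_scheme \<Rightarrow> 'g topology \<Rightarrow> ('g, 'v) rep \<Rightarrow> bool" where
  "admissible G T W \<longleftrightarrow>
     smooth_rep G T W \<and>
     (\<forall>K. open_subgroup G T K \<and> compactin T K \<longrightarrow> fin_dim W (fixed_vectors W K))"

definition subrep :: "('g, 'm) monoid_scheme \<Rightarrow> ('g, 'v) rep \<Rightarrow> 'v set \<Rightarrow> bool" where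
  "subrep G V U \<longleftrightarrow>
     submodule U complex_field V \<and> (\<forall>g\<in>carrier G. \<forall>u\<in>U. act V g u \<in> U)"

definition quot_rep :: "('g, 'v) rep \<Rightarrow> 'v set \<Rightarrow> ('g, 'v set) rep" where
  "quot_rep V U =
     \<lparr>carrier = a_rcosets\<^bsub>V\<^esub> U, mult = undefined, one = undefined,
      zero = U, add = set_add V,
      smult = (\<lambda>c Z. \<Union>x\<in>Z. U +>\<^bsub>V\<^esub> (c \<odot>\<^bsub>V\<^esub> x)),
      act = (\<lambda>g Z. \<Union>x\<in>Z. U +>\<^bsub>V\<^esub> act V g x)\<rparr>"

definition dsum_rep :: "('g, 'a) rep \<Rightarrow> ('g, 'b) rep \<Rightarrow> ('g, 'a \<times> 'b) rep" where
  "dsum_rep A B =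
     \<lparr>carrier = carrier A \<times> carrier B, mult = undefined, one = undefined,
      zero = (\<zero>\<^bsub>A\<^esub>, \<zero>\<^bsub>B\<^esub>), add = (\<lambda>(a, b) (a', b'). (a \<oplus>\<^bsub>A\<^esub> a', b \<oplus>\<^bsub>B\<^esub> b')),
      smult = (\<lambda>c (a, b). (c \<odot>\<^bsub>A\<^esub> a, c \<odot>\<^bsub>B\<^esub> b)),
      act = (\<lambda>g (a, b). (act A g a, act B g b))\<rparr>"


section \<open>Spaces of homomorphisms\<close>

text \<open>
  Linear maps are taken to be \<open>extensional\<close> on the carrier of the source, so that the zero map
  and equality of maps are the expected ones.  The representation \<open>Hom(A, W)\<close> is in general
  not smooth.
\<close>

definition Hom_rep ::
    "('g, 'm) monoid_scheme \<Rightarrow> ('g, 'a) rep \<Rightarrow> ('g, 'w) rep \<Rightarrow> ('g, 'a \<Rightarrow> 'w) rep" where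
  "Hom_rep G A W =
     \<lparr>carrier = {f \<in> extensional (carrier A). linear_map A W f},
      mult = undefined, one = undefined,
      zero = (\<lambda>a\<in>carrier A. \<zero>\<^bsub>W\<^esub>),
      add = (\<lambda>f h. \<lambda>a\<in>carrier A. f a \<oplus>\<^bsub>W\<^esub> h a),
      smult = (\<lambda>c f. \<lambda>a\<in>carrier A. c \<odot>\<^bsub>W\<^esub> f a),
      act = (\<lambda>g f. \<lambda>a\<in>carrier A. act W g (f (act A (inv\<^bsub>G\<^esub> g) a)))\<rparr>"

text \<open>The element \<open>(g\<^sub>1 - 1) (g\<^sub>2 - 1) \<dots> (g\<^sub>n - 1) \<cdot> x\<close>.\<close>

definition aug_prod :: "('g, 'v) rep \<Rightarrow> 'g list \<Rightarrow> 'v \<Rightarrow> 'v" where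
  "aug_prod V gs x = foldr (\<lambda>g y. act V g y \<ominus>\<^bsub>V\<^esub> y) gs x"

definition Hom_Gk ::
    "('g, 'm) monoid_scheme \<Rightarrow> nat \<Rightarrow> ('g, 'a) rep \<Rightarrow> ('g, 'w) rep \<Rightarrow> ('a \<Rightarrow> 'w) set" where
  "Hom_Gk G k A W =
     {\<eta> \<in> carrier (Hom_rep G A W).
        \<forall>gs. length gs = Suc k \<and> set gs \<subseteq> carrier G \<longrightarrow>
          aug_prod (Hom_rep G A W) gs \<eta> = \<zero>\<^bsub>Hom_rep G A W\<^esub>}"

definition Hom_Ginf ::
    "('g, 'm) monoid_scheme \<Rightarrow> ('g, 'a) rep \<Rightarrow> ('g, 'w) rep \<Rightarrow> ('a \<Rightarrow> 'w) set" where
  "Hom_Ginf G A W = (\<Union>k. Hom_Gk G k A W)"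


section \<open>Yoneda \<open>Ext\<^sup>1\<close> and the connecting homomorphism\<close>

text \<open>
  \<open>Ext\<^sup>1\<^sub>G(A, W)\<close> is the set of equivalence classes of extensions
  \<open>0 \<rightarrow> W \<rightarrow> E \<rightarrow> A \<rightarrow> 0\<close> of smooth representations.  Its zero element (the neutral element
  for the Baer sum) is the class of \<open>W \<oplus> A\<close>.
\<close>

type_synonym ('g, 'a, 'w, 'e) extn = "('g, 'e) rep \<times> ('w \<Rightarrow> 'e) \<times> ('e \<Rightarrow> 'a)"

definition is_extension ::
    "('g, 'm) monoid_scheme \<Rightarrow> 'g topology \<Rightarrow> ('g, 'a) rep \<Rightarrow> ('g, 'w) rep \<Rightarrow>
     ('g, 'a, 'w, 'e) extn \<Rightarrow> bool" where
  "is_extension G T A W = (\<lambda>(E, i, p).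
     smooth_rep G T E \<and>
     intertwiner G W E i \<and> inj_on i (carrier W) \<and>
     intertwiner G E A p \<and> p ` carrier E = carrier A \<and>
     i ` carrier W = a_kernel E A p)"

definition extn_equiv ::
    "('g, 'm) monoid_scheme \<Rightarrow> ('g, 'w) rep \<Rightarrow>
     ('g, 'a, 'w, 'e) extn \<Rightarrow> ('g, 'a, 'w, 'f) extn \<Rightarrow> bool" where
  "extn_equiv G W = (\<lambda>(E, i, p) (E', i', p').
     \<exists>\<phi>. intertwiner G E E' \<phi> \<and> bij_betw \<phi> (carrier E) (carrier E') \<and>
       (\<forall>w\<in>carrier W. \<phi> (i w) = i' w) \<and> (\<forall>e\<in>carrier E. p' (\<phi> e) = p e))"

text \<open>
  The middle term \<open>E\<close> of an extension may live on any type.  Since \<open>E\<close> is in bijection with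
  \<open>W \<times> A\<close>, every extension is equivalent to one whose underlying set is contained in the type
  \<open>'w \<times> 'a\<close>, and its class is represented by the set of all such extensions.
\<close>

definition extn_class ::
    "('g, 'm) monoid_scheme \<Rightarrow> 'g topology \<Rightarrow> ('g, 'a) rep \<Rightarrow> ('g, 'w) rep \<Rightarrow>
     ('g, 'a, 'w, 'e) extn \<Rightarrow> ('g, 'a, 'w, 'w \<times> 'a) extn set" where
  "extn_class G T A W Z = {Y. is_extension G T A W Y \<and> extn_equiv G W Z Y}"

definition Ext1 ::
    "('g, 'm) monoid_scheme \<Rightarrow> 'g topology \<Rightarrow> ('g, 'a) rep \<Rightarrow> ('g, 'w) rep \<Rightarrow>
     ('g, 'a, 'w, 'w \<times> 'a) extn set set" where
  "Ext1 G T A W =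
     extn_class G T A W ` {Z :: ('g, 'a, 'w, 'w \<times> 'a) extn. is_extension G T A W Z}"

definition Ext1_zero ::
    "('g, 'm) monoid_scheme \<Rightarrow> 'g topology \<Rightarrow> ('g, 'a) rep \<Rightarrow> ('g, 'w) rep \<Rightarrow>
     ('g, 'a, 'w, 'w \<times> 'a) extn set" where
  "Ext1_zero G T A W = extn_class G T A W (dsum_rep W A, (\<lambda>w. (w, \<zero>\<^bsub>A\<^esub>)), snd)"

text \<open>
  The connecting homomorphism \<open>Hom\<^sub>G(U, W) \<rightarrow> Ext\<^sup>1\<^sub>G(V/U, W)\<close> sends \<open>f\<close> to the pushout along \<open>f\<close>
  of the extension \<open>0 \<rightarrow> U \<rightarrow> V \<rightarrow> V/U \<rightarrow> 0\<close>; its middle term is the quotient of \<open>W \<oplus> V\<close> by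
  the graph \<open>{(f u, - u) | u \<in> U}\<close>.
\<close>

definition pushout_graph :: "('g, 'v) rep \<Rightarrow> 'v set \<Rightarrow> ('v \<Rightarrow> 'w) \<Rightarrow> ('w \<times> 'v) set" where
  "pushout_graph V U f = (\<lambda>u. (f u, \<ominus>\<^bsub>V\<^esub> u)) ` U"

definition pushout_extn ::
    "('g, 'v) rep \<Rightarrow> 'v set \<Rightarrow> ('g, 'w) rep \<Rightarrow> ('v \<Rightarrow> 'w) \<Rightarrow>
     ('g, 'v set, 'w, ('w \<times> 'v) set) extn" where
  "pushout_extn V U W f =
     (quot_rep (dsum_rep W V) (pushout_graph V U f),
      (\<lambda>w. pushout_graph V U f +>\<^bsub>dsum_rep W V\<^esub> (w, \<zero>\<^bsub>V\<^esub>)),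
      (\<lambda>Z. \<Union>(w, v)\<in>Z. U +>\<^bsub>V\<^esub> v))"

definition connecting_hom ::
    "('g, 'm) monoid_scheme \<Rightarrow> 'g topology \<Rightarrow> ('g, 'v) rep \<Rightarrow> 'v set \<Rightarrow> ('g, 'w) rep \<Rightarrow>
     ('v \<Rightarrow> 'w) \<Rightarrow> ('g, 'v set, 'w, 'w \<times> 'v set) extn set" where
  "connecting_hom G T V U W f = extn_class G T (quot_rep V U) W (pushout_extn V U W f)"


section \<open>Meromorphic functions with values in a representation\<close>

text \<open>
  A function with values in a finite-dimensional subspace is meromorphic or holomorphic iff it
  is a linear combination of finitely many vectors with meromorphic or holomorphic coefficients.
  As for \<open>meromorphic_on\<close>, the values on a sparse set, in particular at the poles, are immaterial
  for \<open>vec_meromorphic_on\<close> and \<open>vec_laurent\<close>.  In contrast, \<open>vec_holomorphic_at\<close> does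
  constrain the value at the point.
\<close>

definition vec_meromorphic_on ::
    "('g, 'w) rep \<Rightarrow> 'w set \<Rightarrow> (complex \<Rightarrow> 'w) \<Rightarrow> complex set \<Rightarrow> bool" where
  "vec_meromorphic_on W Z f D \<longleftrightarrow>
     (\<exists>B c. finite B \<and> B \<subseteq> Z \<and> (\<forall>b\<in>B. c b meromorphic_on D) \<and>
        (\<forall>\<^sub>\<approx>s\<in>D. f s = lincomb W (\<lambda>b. c b s) B))"

definition vec_holomorphic_at :: "('g, 'w) rep \<Rightarrow> (complex \<Rightarrow> 'w) \<Rightarrow> complex \<Rightarrow> bool" where
  "vec_holomorphic_at W f s0 \<longleftrightarrow>
     (\<exists>B c. finite B \<and> B \<subseteq> carrier W \<and> (\<forall>b\<in>B. c b analytic_on {s0}) \<and>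
        (\<forall>\<^sub>F s in nhds s0. f s = lincomb W (\<lambda>b. c b s) B))"

text \<open>\<open>L i\<close> is the coefficient of \<open>(s - s0)\<^sup>i\<close> in the Laurent expansion of \<open>f\<close> at \<open>s0\<close>.\<close>

definition vec_laurent ::
    "('g, 'w) rep \<Rightarrow> (complex \<Rightarrow> 'w) \<Rightarrow> complex \<Rightarrow> (int \<Rightarrow> 'w) \<Rightarrow> bool" where
  "vec_laurent W f s0 L \<longleftrightarrow>
     (\<exists>B c F. finite B \<and> B \<subseteq> carrier W \<and>
        (\<forall>b\<in>B. (\<lambda>z. c b (s0 + z)) has_laurent_expansion F b) \<and>
        (\<forall>\<^sub>F s in at s0. f s = lincomb W (\<lambda>b. c b s) B) \<and>
        (\<forall>i. L i = lincomb W (\<lambda>b. fls_nth (F b) i) B))"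


section \<open>Equivariant meromorphic intertwining operators\<close>

definition holomorphic_character ::
    "('g, 'm) monoid_scheme \<Rightarrow> 'g topology \<Rightarrow> complex set \<Rightarrow> (complex \<Rightarrow> 'g \<Rightarrow> complex) \<Rightarrow> bool"
  where
  "holomorphic_character G T D \<omega> \<longleftrightarrow>
     (\<forall>s\<in>D. \<forall>g\<in>carrier G. \<omega> s g \<noteq> 0) \<and>
     (\<forall>g\<in>carrier G. (\<lambda>s. \<omega> s g) holomorphic_on D) \<and>
     (\<exists>K. open_subgroup G T K \<and>
        (\<forall>s\<in>D. (\<forall>g\<in>carrier G. \<forall>h\<in>carrier G. \<omega> s (g \<otimes>\<^bsub>G\<^esub> h) = \<omega> s g * \<omega> s h) \<and>
               (\<forall>k\<in>K. \<omega> s k = 1)))"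

text \<open>
  The set \<open>P\<close> contains all the poles.  The value of \<open>\<xi> s v\<close> for \<open>s \<in> P\<close> is unconstrained here; it is
  meaningful only where \<open>vec_holomorphic_at W (\<lambda>s. \<xi> s v) s\<close> holds.
\<close>

definition meromorphic_intertwiner ::
    "('g, 'm) monoid_scheme \<Rightarrow> 'g topology \<Rightarrow> complex set \<Rightarrow> (complex \<Rightarrow> 'g \<Rightarrow> complex) \<Rightarrow>
     ('g, 'v) rep \<Rightarrow> ('g, 'w) rep \<Rightarrow> (complex \<Rightarrow> 'v \<Rightarrow> 'w) \<Rightarrow> bool" where
  "meromorphic_intertwiner G T D \<omega> V W \<xi> \<longleftrightarrow>
     (\<forall>v\<in>carrier V. \<exists>K. open_subgroup G T K \<and> (\<forall>k\<in>K. act V k v = v) \<and>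
        (\<forall>s\<in>D. \<forall>k\<in>K. \<omega> s k = 1) \<and>
        vec_meromorphic_on W (fixed_vectors W K) (\<lambda>s. \<xi> s v) D) \<and>
     (\<exists>P. P \<subseteq> D \<and> discrete P \<and>
        (\<forall>s\<in>D - P. linear_map V W (\<xi> s) \<and>
           (\<forall>g\<in>carrier G. \<forall>v\<in>carrier V. act W g (\<xi> s v) = \<omega> s g \<odot>\<^bsub>W\<^esub> \<xi> s (act V g v)) \<and>
           (\<forall>v\<in>carrier V. vec_holomorphic_at W (\<lambda>s. \<xi> s v) s)) \<and>
        (\<forall>p\<in>P. \<exists>n::nat. \<forall>v\<in>carrier V. \<exists>L.
           vec_laurent W (\<lambda>s. \<xi> s v) p L \<and> (\<forall>i < - int n. L i = \<zero>\<^bsub>W\<^esub>)))"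

definition has_pole_order ::
    "('g, 'v) rep \<Rightarrow> ('g, 'w) rep \<Rightarrow> (complex \<Rightarrow> 'v \<Rightarrow> 'w) \<Rightarrow> complex \<Rightarrow> nat \<Rightarrow> bool" where
  "has_pole_order V W \<xi> s0 k0 \<longleftrightarrow>
     (\<exists>\<xi>c. (\<forall>i. linear_map V W (\<xi>c i)) \<and>
        (\<forall>v\<in>carrier V. vec_laurent W (\<lambda>s. \<xi> s v) s0 (\<lambda>i. \<xi>c i v)) \<and>
        (\<forall>i < - int k0. \<forall>v\<in>carrier V. \<xi>c i v = \<zero>\<^bsub>W\<^esub>) \<and>
        (\<exists>v\<in>carrier V. \<xi>c (- int k0) v \<noteq> \<zero>\<^bsub>W\<^esub>))"

end

(*
  If the connecting map killed \<xi>|U(s0), the pushout extension would split, and \<xi>|U(s0) = \<xi>_0|U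
  would extend to an intertwiner \<eta> : V -> W.  Equivariance reads
  (g - 1) \<xi>(s) = (\<omega>(s, g) - 1) \<xi>(s), so (g_1 - 1) ... (g_n - 1) \<xi>(s) = a(s) \<xi>(s) where a vanishes to
  order n at s0 with leading coefficient the product of the \<omega>'(s0, g_i).  Comparing constant
  terms, k0 + 1 factors annihilate \<xi>_0, while (g_1 - 1) ... (g_k0 - 1) \<xi>_0 is a nonzero multiple
  of the leading Laurent coefficient \<xi>_{-k0}.  Since \<xi>_0 - \<eta> vanishes on U, it descends to an
  element of Hom_{G,k0}(V/U, W), on which (g_1 - 1) ... (g_k0 - 1) acts by zero; as this product
  also kills \<eta>, it kills \<xi>_0, and \<xi>_{-k0} = 0, a contradiction.
*)

theory Submission
  imports Defs
begin

section \<open>Linear algebra over the complex numbers\<close>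

text \<open>The finite families expressing the vector-valued functions depend on the vector v and
  need not be linearly independent. Every comparison is therefore made at a fixed v, and uniqueness
  of Laurent coefficients has to be proved by eliminating redundant vectors. Moreover, at a pole the
  conditions on \<xi> leave linearity and equivariance of \<xi>(s0) open, so on U both are read off
  the coefficient \<xi>_0: equivariance there is the comparison of constant terms for a single
  factor, where \<xi>_{-1} is zero on U. The same comparison thus serves for 1, k0 and k0 + 1
  factors. It is formulated for plain functions, since \<xi>(s) need be neither extensional nor, for
  every s, linear. A class in Ext^1 is a set of extensions; equality with the zero class makes the
  split extension a member of the pushout class, which yields an actual isomorphism to work
  with.\<close>

lemma complex_field_simps [simp]:
  "carrier complex_field = UNIV"
  "a \<oplus>\<^bsub>complex_field\<^esub> b = a + b"
  "a \<otimes>\<^bsub>complex_field\<^esub> b = a * b"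
  "\<zero>\<^bsub>complex_field\<^esub> = 0"
  "\<one>\<^bsub>complex_field\<^esub> = 1"
  by (simp_all add: ring_of_type_algebra_def)

lemma a_inv_complex_field [simp]: "\<ominus>\<^bsub>complex_field\<^esub> a = - a"
proof -
  interpret ring complex_field by (rule ring_from_type_algebra)
  show ?thesis by (rule minus_equality) auto
qed

section \<open>Complex modules and finite linear combinations\<close>

locale complex_module = module complex_field W for W :: "('g, 'w) rep" (structure)
begin

lemma smult_add_left: "x \<in> carrier W \<Longrightarrow> (a + b) \<odot> x = a \<odot> x \<oplus> b \<odot> x"
  using smult_l_distr[of a b x] by simp

lemma smult_mult: "x \<in> carrier W \<Longrightarrow> (a * b) \<odot> x = a \<odot> (b \<odot> x)"
  using smult_assoc1[of a b x] by simp

lemma smult_0_left [simp]: "x \<in> carrier W \<Longrightarrow> 0 \<odot> x = \<zero>"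
  using smult_l_null[of x] by simp

lemma smult_0_right [simp]: "a \<odot> \<zero> = \<zero>"
  using smult_r_null[of a] by simp

lemma smult_1 [simp]: "x \<in> carrier W \<Longrightarrow> 1 \<odot> x = x"
  using smult_one[of x] by simp

lemma smult_in_carrier [simp]: "x \<in> carrier W \<Longrightarrow> a \<odot> x \<in> carrier W"
  by simp

lemma smult_add_right:
  "x \<in> carrier W \<Longrightarrow> y \<in> carrier W \<Longrightarrow> a \<odot> (x \<oplus> y) = a \<odot> x \<oplus> a \<odot> y"
  using smult_r_distr[of a x y] by simp

lemma smult_minus_left: "x \<in> carrier W \<Longrightarrow> (- a) \<odot> x = \<ominus> (a \<odot> x)"
  using smult_l_minus[of a x] by simp

lemma smult_minus_right: "x \<in> carrier W \<Longrightarrow> a \<odot> (\<ominus> x) = \<ominus> (a \<odot> x)"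
  using smult_r_minus[of a x] by simp

lemma smult_diff_left: "x \<in> carrier W \<Longrightarrow> (a - b) \<odot> x = a \<odot> x \<ominus> b \<odot> x"
  using smult_add_left[of x a "- b"] by (simp add: smult_minus_left a_minus_def)

lemma smult_eq_0_iff:
  assumes "x \<in> carrier W"
  shows "a \<odot> x = \<zero> \<longleftrightarrow> a = 0 \<or> x = \<zero>"
proof -
  have "x = \<zero>" if "a \<odot> x = \<zero>" "a \<noteq> 0"
    using smult_mult[OF assms, of "inverse a" a] that assms by simp
  then show ?thesis using assms by auto
qed

lemma lincomb_closed [simp]: "B \<subseteq> carrier W \<Longrightarrow> lincomb W c B \<in> carrier W"
  unfolding lincomb_def by (intro finsum_closed) auto

lemma lincomb_cong:
  "B \<subseteq> carrier W \<Longrightarrow> (\<And>b. b \<in> B \<Longrightarrow> c b = d b) \<Longrightarrow> lincomb W c B = lincomb W d B"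
  unfolding lincomb_def by (intro finsum_cong') auto

lemma lincomb_add:
  assumes "B \<subseteq> carrier W"
  shows "lincomb W (\<lambda>b. c b + d b) B = lincomb W c B \<oplus> lincomb W d B"
proof -
  have "(\<lambda>b. c b \<odot> b) \<in> B \<rightarrow> carrier W" "(\<lambda>b. d b \<odot> b) \<in> B \<rightarrow> carrier W"
    using assms by auto
  then have "(\<Oplus>b\<in>B. c b \<odot> b \<oplus> d b \<odot> b) = lincomb W c B \<oplus> lincomb W d B"
    unfolding lincomb_def by (rule finsum_addf)
  moreover have "lincomb W (\<lambda>b. c b + d b) B = (\<Oplus>b\<in>B. c b \<odot> b \<oplus> d b \<odot> b)"
    unfolding lincomb_def using assms by (intro finsum_cong') (auto simp: subsetD smult_add_left)
  ultimately show ?thesis by simp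
qed

lemma lincomb_smult:
  assumes "finite B" "B \<subseteq> carrier W"
  shows "lincomb W (\<lambda>b. a * c b) B = a \<odot> lincomb W c B"
  unfolding lincomb_def using assms
  by (subst finsum_smult_ldistr) (auto intro!: finsum_cong' simp: subsetD smult_mult)

lemma lincomb_zero: "B \<subseteq> carrier W \<Longrightarrow> (\<And>b. b \<in> B \<Longrightarrow> c b = 0) \<Longrightarrow> lincomb W c B = \<zero>"
  unfolding lincomb_def by (intro add.finprod_one_eqI) auto

lemma lincomb_extend:
  assumes "finite C" "B \<subseteq> C" "C \<subseteq> carrier W"
  shows "lincomb W (\<lambda>b. if b \<in> B then c b else 0) C = lincomb W c B"
proof -
  have "lincomb W (\<lambda>b. if b \<in> B then c b else 0) C = lincomb W (\<lambda>b. if b \<in> B then c b else 0) B"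
    unfolding lincomb_def using assms
    by (intro add.finprod_mono_neutral_cong_left[symmetric]) auto
  also have "\<dots> = lincomb W c B"
    using assms by (intro lincomb_cong) auto
  finally show ?thesis .
qed

lemma lincomb_insert:
  "finite B \<Longrightarrow> B \<subseteq> carrier W \<Longrightarrow> b \<in> carrier W \<Longrightarrow> b \<notin> B \<Longrightarrow>
     lincomb W c (insert b B) = c b \<odot> b \<oplus> lincomb W c B"
  unfolding lincomb_def by (subst finsum_insert) auto

end

section \<open>Linear maps between complex modules\<close>

lemma linear_map_zero:
  assumes "Module.module complex_field A" "Module.module complex_field B" "linear_map A B f"
  shows "f \<zero>\<^bsub>A\<^esub> = \<zero>\<^bsub>B\<^esub>"
proof -
  interpret A: complex_module A by (rule complex_module.intro) fact
  interpret B: complex_module B by (rule complex_module.intro) fact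
  show ?thesis
    using assms(3) A.smult_0_left[of "\<zero>\<^bsub>A\<^esub>"] B.smult_0_left[of "f \<zero>\<^bsub>A\<^esub>"]
    by (metis A.M.zero_closed PiE linear_map_def)
qed

lemma linear_map_minus:
  assumes "Module.module complex_field A" "Module.module complex_field B" "linear_map A B f"
    and "x \<in> carrier A"
  shows "f (\<ominus>\<^bsub>A\<^esub> x) = \<ominus>\<^bsub>B\<^esub> f x"
proof -
  interpret A: complex_module A by (rule complex_module.intro) fact
  interpret B: complex_module B by (rule complex_module.intro) fact
  have "f x \<in> carrier B" using assms by (auto simp: linear_map_def)
  then have "f ((-1) \<odot>\<^bsub>A\<^esub> x) = \<ominus>\<^bsub>B\<^esub> (1 \<odot>\<^bsub>B\<^esub> f x)"
    using assms B.smult_minus_left[of "f x" 1] by (auto simp: linear_map_def)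
  then show ?thesis
    using assms(4) \<open>f x \<in> carrier B\<close> A.smult_minus_left[of x 1] by simp
qed

lemma linear_map_diff:
  assumes "Module.module complex_field A" "Module.module complex_field B" "linear_map A B f"
    and "x \<in> carrier A" "y \<in> carrier A"
  shows "f (x \<ominus>\<^bsub>A\<^esub> y) = f x \<ominus>\<^bsub>B\<^esub> f y"
proof -
  interpret A: complex_module A by (rule complex_module.intro) fact
  have "f (x \<oplus>\<^bsub>A\<^esub> \<ominus>\<^bsub>A\<^esub> y) = f x \<oplus>\<^bsub>B\<^esub> f (\<ominus>\<^bsub>A\<^esub> y)"
    using assms A.a_inv_closed unfolding linear_map_def by blast
  then show ?thesis
    using linear_map_minus[OF assms(1-3,5)] by (simp add: a_minus_def)
qed

text \<open>\<open>lincomb\<close> indexes coefficients by the vectors themselves, so pushing a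
  combination forward re-indexes it by image vectors. Injectivity on \<open>S\<close> prevents two
  summands from collapsing into one.\<close>

lemma linear_map_lincomb:
  assumes "Module.module complex_field A" "Module.module complex_field B" "linear_map A B f"
    and "finite S" "S \<subseteq> carrier A" "inj_on f S"
  shows "f (lincomb A (\<lambda>b. c (f b)) S) = lincomb B c (f ` S)"
proof -
  interpret A: complex_module A by (rule complex_module.intro) fact
  interpret B: complex_module B by (rule complex_module.intro) fact
  have cl: "f x \<in> carrier B" if "x \<in> carrier A" for x
    using assms(3) that by (auto simp: linear_map_def)
  show ?thesis
    using assms(4-6)
  proof (induction S rule: finite_induct)
    case empty
    then show ?case
      using linear_map_zero[OF assms(1-3)] by (simp add: lincomb_def)
  next
    case (insert x S)
    let ?d = "\<lambda>b. c (f b)"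
    have x: "x \<in> carrier A" and S: "S \<subseteq> carrier A" using insert.prems by auto
    have "f (lincomb A ?d (insert x S)) = f (c (f x) \<odot>\<^bsub>A\<^esub> x \<oplus>\<^bsub>A\<^esub> lincomb A ?d S)"
      using insert.hyps x S by (simp add: A.lincomb_insert)
    also have "\<dots> = c (f x) \<odot>\<^bsub>B\<^esub> f x \<oplus>\<^bsub>B\<^esub> f (lincomb A ?d S)"
      using assms(3) x A.lincomb_closed[OF S, of ?d] A.smult_in_carrier[OF x]
      unfolding linear_map_def by metis
    also have "\<dots> = lincomb B c (insert (f x) (f ` S))"
      using insert x S cl by (subst B.lincomb_insert) auto
    finally show ?case by simp
  qed
qed

section \<open>Laurent expansions\<close>

text \<open>The Cauchy product, summed over a range that depends only on the bound \<open>N\<close>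
  and not on the exact subdegrees, so that one range fits all series of a finite family.\<close>

lemma fps_to_fls_times_nth_0:
  fixes A :: "'a :: comm_ring_1 fps"
  assumes "- int N \<le> fls_subdegree F"
  shows "fls_nth (fps_to_fls A * F) 0 = (\<Sum>j\<le>N. fps_nth A j * fls_nth F (- int j))"
proof -
  let ?A = "fps_to_fls A"
  have "fls_nth (?A * F) 0 = (\<Sum>i=fls_subdegree ?A..0 - fls_subdegree F. fls_nth ?A i * fls_nth F (0 - i))"
    by (rule fls_times_nth(2))
  also have "\<dots> = (\<Sum>i\<in>int ` {..N}. fls_nth ?A i * fls_nth F (- i))"
  proof (rule sum.mono_neutral_cong)
    show "fls_nth ?A i * fls_nth F (0 - i) = 0"
      if "i \<in> {fls_subdegree ?A..0 - fls_subdegree F} - int ` {..N}" for i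
    proof -
      \<comment> \<open>A vacuous case: the range given by the subdegrees is contained in 0, ...,
        \<open>N\<close>.\<close>
      from that assms fls_subdegree_fls_to_fps_gt0[of A] have "0 \<le> i" "i \<le> int N" by auto
      then have "i \<in> int ` {..N}" by (intro image_eqI[of _ _ "nat i"]) auto
      with that show ?thesis by simp
    qed
    show "fls_nth ?A i * fls_nth F (- i) = 0"
      if "i \<in> int ` {..N} - {fls_subdegree ?A..0 - fls_subdegree F}" for i
    proof -
      from that have "i < fls_subdegree ?A \<or> - i < fls_subdegree F" by auto
      then show ?thesis
        by (metis fls_eq0_below_subdegree mult_zero_left mult_zero_right)
    qed
  qed auto
  also have "\<dots> = (\<Sum>j\<le>N. fps_nth A j * fls_nth F (- int j))"
    by (subst sum.reindex) (auto simp: inj_on_def)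
  finally show ?thesis .
qed

text \<open>Each factor vanishes at \<open>s0\<close> and so contributes one \<open>fps_X\<close>;
  the cofactor has the derivative as constant term. The zeros may have higher order, which lets the
  result apply to arbitrary lists of group elements.\<close>

lemma has_fps_expansion_prod_list_simple_zeros:
  fixes a :: "'b \<Rightarrow> complex \<Rightarrow> complex"
  assumes "\<And>g. g \<in> set gs \<Longrightarrow> a g analytic_on {s0}" "\<And>g. g \<in> set gs \<Longrightarrow> a g s0 = 0"
  shows "\<exists>Q. (\<lambda>z. \<Prod>g\<leftarrow>gs. a g (s0 + z)) has_fps_expansion fps_X ^ length gs * Q \<and>
             fps_nth Q 0 = (\<Prod>g\<leftarrow>gs. deriv (a g) s0)"
  using assms
proof (induction gs)
  case Nil
  then show ?case by (intro exI[of _ 1]) auto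
next
  case (Cons g gs)
  then obtain Q where Q: "(\<lambda>z. \<Prod>g\<leftarrow>gs. a g (s0 + z)) has_fps_expansion fps_X ^ length gs * Q"
    "fps_nth Q 0 = (\<Prod>g\<leftarrow>gs. deriv (a g) s0)" by auto
  define A where "A = fps_expansion (a g) s0"
  have A: "(\<lambda>z. a g (s0 + z)) has_fps_expansion A"
    unfolding A_def using Cons.prems by (intro analytic_at_imp_has_fps_expansion) auto
  have "fps_nth A 0 = 0"
    using Cons.prems(2)[of g] by (simp add: A_def fps_expansion_def)
  then have "A = fps_X * fps_shift 1 A"
    by (intro fps_ext) simp
  then have "A * (fps_X ^ length gs * Q) = fps_X ^ Suc (length gs) * (fps_shift 1 A * Q)"
    by (metis (no_types, opaque_lifting) mult.assoc mult.commute power_Suc)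
  moreover have "fps_nth (fps_shift 1 A * Q) 0 = deriv (a g) s0 * (\<Prod>g\<leftarrow>gs. deriv (a g) s0)"
    using Q(2) by (simp add: A_def fps_expansion_def)
  moreover have "(\<lambda>z. \<Prod>h\<leftarrow>g # gs. a h (s0 + z)) has_fps_expansion A * (fps_X ^ length gs * Q)"
    using has_fps_expansion_mult[OF A Q(1)] by simp
  ultimately show ?case
    by (intro exI[of _ "fps_shift 1 A * Q"]) (simp only: list.size list.map prod_list.Cons add_0_right add_Suc_right simp_thms)
qed

section \<open>Laurent expansions of functions with values in a module\<close>

context complex_module
begin

lemma diff_eq_0_iff:
  assumes "x \<in> carrier W" "y \<in> carrier W"
  shows "x \<ominus> y = \<zero> \<longleftrightarrow> x = y"
proof
  assume "x \<ominus> y = \<zero>"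
  then have "x \<oplus> \<ominus> y = \<zero>" by (simp add: a_minus_def)
  then show "x = y" using assms M.minus_equality M.minus_minus by fastforce
qed (use assms M.r_neg in \<open>simp add: a_minus_def\<close>)

lemma lincomb_diff:
  assumes "finite B" "B \<subseteq> carrier W"
  shows "lincomb W (\<lambda>b. c b - d b) B = lincomb W c B \<ominus> lincomb W d B"
proof -
  have "lincomb W (\<lambda>b. c b + (-1) * d b) B = lincomb W c B \<oplus> (-1) \<odot> lincomb W d B"
    using assms by (simp only: lincomb_add lincomb_smult)
  then show ?thesis
    using smult_minus_left[of "lincomb W d B" 1] assms by (simp add: a_minus_def)
qed

text \<open>
  The vectors in \<open>B\<close> may be linearly dependent; the coefficients of a redundant vector are
  then distributed over the others.
\<close>

lemma lincomb_laurent_eq_0: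
  assumes "finite B" "B \<subseteq> carrier W"
    and "\<And>b. b \<in> B \<Longrightarrow> (\<lambda>z. c b (s0 + z)) has_laurent_expansion F b"
    and "\<forall>\<^sub>F s in at s0. lincomb W (\<lambda>b. c b s) B = \<zero>"
  shows "lincomb W (\<lambda>b. fls_nth (F b) i) B = \<zero>"
  using assms
proof (induction "card B" arbitrary: B c F)
  case 0
  then show ?case by (simp add: lincomb_def)
next
  case (Suc n B c F)
  show ?case
  proof (cases "\<forall>d. lincomb W d B = \<zero> \<longrightarrow> (\<forall>b\<in>B. d b = 0)")
    \<comment> \<open>Here \<open>B\<close> is linearly independent, so each coefficient function
      vanishes near \<open>s0\<close> and its scalar Laurent series is zero.\<close>
    case True
    have "F b = 0" if b: "b \<in> B" for b
    proof -
      have "\<forall>\<^sub>F s in at s0. c b s = 0"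
        using Suc.prems(4) by eventually_elim (use True b in blast)
      then have "\<forall>\<^sub>F z in at 0. c b (s0 + z) = 0"
        by (simp add: at_to_0[of s0] eventually_filtermap add.commute)
      then have "(\<lambda>z. 0) has_laurent_expansion F b"
        using Suc.prems(3)[OF b] has_laurent_expansion_cong by fast
      then show "F b = 0"
        using has_laurent_expansion_unique by blast
    qed
    then show ?thesis
      using Suc.prems(2) by (intro lincomb_zero) auto
  next
    case False
    then obtain d b0 where d: "lincomb W d B = \<zero>" "b0 \<in> B" "d b0 \<noteq> 0" by blast
    define B' where "B' = B - {b0}"
    \<comment> \<open>Solving the relation \<open>d\<close> for \<open>b0\<close> writes
      \<open>b0\<close> as the sum of \<open>e b\<close> times \<open>b\<close> over
      \<open>B'\<close>. At \<open>b0\<close> itself \<open>e\<close> is -1, so adding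
      \<open>x b0\<close> times \<open>e\<close> cancels the coefficient of
      \<open>b0\<close>.\<close>
    define e where "e = (\<lambda>b. - (d b / d b0))"
    have B': "finite B'" "B' \<subseteq> carrier W" "card B' = n" "b0 \<notin> B'" "B = insert b0 B'" "b0 \<in> carrier W"
      using Suc.prems Suc.hyps(2) d(2) by (auto simp: B'_def)
    have eliminate: "lincomb W x B = lincomb W (\<lambda>b. x b + e b * x b0) B'" for x
    proof -
      let ?y = "\<lambda>b. x b + e b * x b0"
      have "lincomb W ?y B = lincomb W (\<lambda>b. x b + (- (x b0 / d b0)) * d b) B"
        by (simp add: e_def mult.commute)
      also have "\<dots> = lincomb W x B"
        using Suc.prems(1,2) d(1) by (simp only: lincomb_add lincomb_smult) simp
      finally have "lincomb W x B = lincomb W ?y (insert b0 B')"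
        using B'(5) by simp
      also have "\<dots> = lincomb W ?y B'"
        using B' d(3) by (subst lincomb_insert) (auto simp: e_def)
      finally show ?thesis .
    qed
    \<comment> \<open>The numbers \<open>e b\<close> do not depend on s, so the same elimination
      acts on the coefficient functions and on their series, and the smaller family
      \<open>B'\<close> satisfies the hypotheses.\<close>
    have "lincomb W (\<lambda>b. fls_nth (F b + fls_const (e b) * F b0) i) B' = \<zero>"
    proof (rule Suc.hyps(1)[of B' "\<lambda>b s. c b s + e b * c b0 s"])
      show "(\<lambda>z. c b (s0 + z) + e b * c b0 (s0 + z)) has_laurent_expansion
              F b + fls_const (e b) * F b0" if "b \<in> B'" for b
        using Suc.prems(3) that d(2) B'(5)
        by (intro has_laurent_expansion_add has_laurent_expansion_cmult_left) auto
      show "\<forall>\<^sub>F s in at s0. lincomb W (\<lambda>b. c b s + e b * c b0 s) B' = \<zero>"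
        using Suc.prems(4) by (simp add: eliminate)
    qed (use B' in auto)
    then show ?thesis by (simp add: eliminate)
  qed
qed

text \<open>Padding with zero coefficients; it puts two expansions over the union of their families,
  where they can be subtracted coefficientwise.\<close>

lemma vec_laurent_basis_extend:
  assumes "finite C" "B \<subseteq> C" "C \<subseteq> carrier W"
    and "\<forall>b\<in>B. (\<lambda>z. c b (s0 + z)) has_laurent_expansion F b"
    and "\<forall>\<^sub>F s in at s0. f s = lincomb W (\<lambda>b. c b s) B"
    and "\<forall>i. L i = lincomb W (\<lambda>b. fls_nth (F b) i) B"
  shows "\<exists>c F. (\<forall>b\<in>C. (\<lambda>z. c b (s0 + z)) has_laurent_expansion F b) \<and>
           (\<forall>\<^sub>F s in at s0. f s = lincomb W (\<lambda>b. c b s) C) \<and>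
           (\<forall>i. L i = lincomb W (\<lambda>b. fls_nth (F b) i) C)"
proof (intro exI conjI)
  let ?c = "\<lambda>b s. if b \<in> B then c b s else 0" and ?F = "\<lambda>b. if b \<in> B then F b else 0"
  show "\<forall>b\<in>C. (\<lambda>z. ?c b (s0 + z)) has_laurent_expansion ?F b"
    using assms(4) by auto
  show "\<forall>\<^sub>F s in at s0. f s = lincomb W (\<lambda>b. ?c b s) C"
    using assms(5) by (simp add: lincomb_extend[OF assms(1-3)])
  have "(\<lambda>b. fls_nth (?F b) i) = (\<lambda>b. if b \<in> B then fls_nth (F b) i else 0)" for i
    by auto
  then show "\<forall>i. L i = lincomb W (\<lambda>b. fls_nth (?F b) i) C"
    using assms(6) by (simp add: lincomb_extend[OF assms(1-3)])
qed

lemma vec_laurent_closed: "vec_laurent W f s0 L \<Longrightarrow> L i \<in> carrier W"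
  unfolding vec_laurent_def by auto

lemma vec_laurent_diff:
  assumes "vec_laurent W f s0 L" "vec_laurent W h s0 M"
  shows "vec_laurent W (\<lambda>s. f s \<ominus> h s) s0 (\<lambda>i. L i \<ominus> M i)"
proof -
  from assms(1) obtain B1 c1 F1 where 1: "finite B1" "B1 \<subseteq> carrier W"
    "\<forall>b\<in>B1. (\<lambda>z. c1 b (s0 + z)) has_laurent_expansion F1 b"
    "\<forall>\<^sub>F s in at s0. f s = lincomb W (\<lambda>b. c1 b s) B1"
    "\<forall>i. L i = lincomb W (\<lambda>b. fls_nth (F1 b) i) B1"
    unfolding vec_laurent_def by blast
  from assms(2) obtain B2 c2 F2 where 2: "finite B2" "B2 \<subseteq> carrier W"
    "\<forall>b\<in>B2. (\<lambda>z. c2 b (s0 + z)) has_laurent_expansion F2 b"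
    "\<forall>\<^sub>F s in at s0. h s = lincomb W (\<lambda>b. c2 b s) B2"
    "\<forall>i. M i = lincomb W (\<lambda>b. fls_nth (F2 b) i) B2"
    unfolding vec_laurent_def by blast
  let ?B = "B1 \<union> B2"
  have B: "finite ?B" "?B \<subseteq> carrier W" using 1 2 by auto
  obtain c F where c: "\<forall>b\<in>?B. (\<lambda>z. c b (s0 + z)) has_laurent_expansion F b"
      "\<forall>\<^sub>F s in at s0. f s = lincomb W (\<lambda>b. c b s) ?B"
      "\<forall>i. L i = lincomb W (\<lambda>b. fls_nth (F b) i) ?B"
    using vec_laurent_basis_extend[OF B(1) _ B(2) 1(3-5)] by auto
  obtain d H where d: "\<forall>b\<in>?B. (\<lambda>z. d b (s0 + z)) has_laurent_expansion H b"
      "\<forall>\<^sub>F s in at s0. h s = lincomb W (\<lambda>b. d b s) ?B"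
      "\<forall>i. M i = lincomb W (\<lambda>b. fls_nth (H b) i) ?B"
    using vec_laurent_basis_extend[OF B(1) _ B(2) 2(3-5)] by auto
  show ?thesis
    unfolding vec_laurent_def
  proof (intro exI[of _ ?B] exI[of _ "\<lambda>b s. c b s - d b s"] exI[of _ "\<lambda>b. F b - H b"] conjI)
    show "\<forall>b\<in>?B. (\<lambda>z. c b (s0 + z) - d b (s0 + z)) has_laurent_expansion F b - H b"
      using c(1) d(1) by (auto intro: has_laurent_expansion_diff)
    show "\<forall>\<^sub>F s in at s0. f s \<ominus> h s = lincomb W (\<lambda>b. c b s - d b s) ?B"
      using c(2) d(2) by eventually_elim (simp add: lincomb_diff[OF B])
    show "\<forall>i. L i \<ominus> M i = lincomb W (\<lambda>b. fls_nth (F b - H b) i) ?B"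
      using c(3) d(3) by (simp add: lincomb_diff[OF B])
  qed (fact B)+
qed

text \<open>The two expansions may use different families, so their coefficients are compared
  through the expansion of the difference, which vanishes near \<open>s0\<close>. Only a punctured
  neighbourhood is involved: the values at a pole do not affect the coefficients.\<close>

lemma vec_laurent_unique:
  assumes "vec_laurent W f s0 L" "vec_laurent W h s0 M" "\<forall>\<^sub>F s in at s0. f s = h s"
  shows "L i = M i"
proof -
  from vec_laurent_diff[OF assms(1,2)] obtain B c F where B: "finite B" "B \<subseteq> carrier W"
    "\<forall>b\<in>B. (\<lambda>z. c b (s0 + z)) has_laurent_expansion F b"
    "\<forall>\<^sub>F s in at s0. f s \<ominus> h s = lincomb W (\<lambda>b. c b s) B"
    "\<forall>i. L i \<ominus> M i = lincomb W (\<lambda>b. fls_nth (F b) i) B"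
    unfolding vec_laurent_def by blast
  \<comment> \<open>Membership in the carrier is read off the expansion; it is what makes
    \<open>f s \<ominus> f s\<close> equal to zero.\<close>
  from assms(1) have "\<forall>\<^sub>F s in at s0. f s \<in> carrier W"
    unfolding vec_laurent_def by (auto elim: eventually_mono)
  with B(4) assms(3) have "\<forall>\<^sub>F s in at s0. lincomb W (\<lambda>b. c b s) B = \<zero>"
    by eventually_elim (metis M.r_neg a_minus_def)
  then have "L i \<ominus> M i = \<zero>"
    using lincomb_laurent_eq_0[OF B(1,2), of c s0 F i] B(3,5) by simp
  then show ?thesis
    using vec_laurent_closed assms(1,2) diff_eq_0_iff by blast
qed

lemma vec_laurent_linear_image:
  assumes "vec_laurent W f s0 L" "linear_map W W h" "inj_on h (carrier W)"
  shows "vec_laurent W (\<lambda>s. h (f s)) s0 (\<lambda>i. h (L i))"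
proof -
  from assms(1) obtain B c F where B: "finite B" "B \<subseteq> carrier W"
    "\<forall>b\<in>B. (\<lambda>z. c b (s0 + z)) has_laurent_expansion F b"
    "\<forall>\<^sub>F s in at s0. f s = lincomb W (\<lambda>b. c b s) B"
    "\<forall>i. L i = lincomb W (\<lambda>b. fls_nth (F b) i) B"
    unfolding vec_laurent_def by blast
  have inj: "inj_on h B" using assms(3) B(2) by (rule inj_on_subset)
  let ?k = "inv_into B h"
  have image: "h (lincomb W x B) = lincomb W (\<lambda>b. x (?k b)) (h ` B)" for x
  proof -
    have "lincomb W x B = lincomb W (\<lambda>b. x (?k (h b))) B"
      using B(2) inj by (intro lincomb_cong) auto
    then show ?thesis
      using linear_map_lincomb[OF module_axioms module_axioms assms(2) B(1,2) inj, of "\<lambda>b. x (?k b)"]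
      by simp
  qed
  show ?thesis
    unfolding vec_laurent_def
  proof (intro exI[of _ "h ` B"] exI[of _ "\<lambda>b. c (?k b)"] exI[of _ "\<lambda>b. F (?k b)"] conjI)
    show "finite (h ` B)" "h ` B \<subseteq> carrier W"
      using B(1,2) assms(2) by (auto simp: linear_map_def)
    show "\<forall>b\<in>h ` B. (\<lambda>z. c (?k b) (s0 + z)) has_laurent_expansion F (?k b)"
      using B(3) inj by auto
    show "\<forall>\<^sub>F s in at s0. h (f s) = lincomb W (\<lambda>b. c (?k b) s) (h ` B)"
      using B(4) by eventually_elim (simp add: image)
    show "\<forall>i. h (L i) = lincomb W (\<lambda>b. fls_nth (F (?k b)) i) (h ` B)"
      using B(5) by (simp add: image)
  qed
qed

text \<open>A scalar vanishing to order at least \<open>n\<close> meets a pole of order at most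
  \<open>n\<close>: in the constant term of the product all contributions but one have a zero
  factor.\<close>

lemma vec_laurent_smult_nth_0:
  assumes "vec_laurent W f s0 L" "(\<lambda>z. a (s0 + z)) has_fps_expansion A"
    and A: "\<And>j. j < n \<Longrightarrow> fps_nth A j = 0" and L: "\<And>i. i < - int n \<Longrightarrow> L i = \<zero>"
  shows "\<exists>M. vec_laurent W (\<lambda>s. a s \<odot> f s) s0 M \<and> M 0 = fps_nth A n \<odot> L (- int n)"
proof -
  from assms(1) obtain B c F where B: "finite B" "B \<subseteq> carrier W"
    "\<forall>b\<in>B. (\<lambda>z. c b (s0 + z)) has_laurent_expansion F b"
    "\<forall>\<^sub>F s in at s0. f s = lincomb W (\<lambda>b. c b s) B"
    "\<forall>i. L i = lincomb W (\<lambda>b. fls_nth (F b) i) B"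
    unfolding vec_laurent_def by blast
  define M where "M i = lincomb W (\<lambda>b. fls_nth (fps_to_fls A * F b) i) B" for i
  have "vec_laurent W (\<lambda>s. a s \<odot> f s) s0 M"
    unfolding vec_laurent_def
  proof (intro exI[of _ B] exI[of _ "\<lambda>b s. a s * c b s"] exI[of _ "\<lambda>b. fps_to_fls A * F b"] conjI)
    show "\<forall>b\<in>B. (\<lambda>z. a (s0 + z) * c b (s0 + z)) has_laurent_expansion fps_to_fls A * F b"
      using B(3) has_laurent_expansion_fps[OF assms(2)]
      by (auto intro: has_laurent_expansion_mult)
    show "\<forall>\<^sub>F s in at s0. a s \<odot> f s = lincomb W (\<lambda>b. a s * c b s) B"
      using B(4) by eventually_elim (simp add: lincomb_smult[OF B(1,2)])
  qed (use B(1,2) M_def in auto)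
  moreover have "M 0 = fps_nth A n \<odot> L (- int n)"
  proof -
    \<comment> \<open>\<open>n\<close> itself is no bound for the scalar series: when
      \<open>B\<close> is dependent, \<open>F b\<close> may have a deeper pole although the combined
      coefficients \<open>L i\<close> vanish below \<open>- int n\<close>.\<close>
    obtain N where N: "\<And>b. b \<in> B \<Longrightarrow> - int N \<le> fls_subdegree (F b)" "n \<le> N"
    proof
      let ?S = "insert n ((\<lambda>b. nat (- fls_subdegree (F b))) ` B)"
      show "n \<le> Max ?S" using B(1) by (intro Max_ge) auto
      show "- int (Max ?S) \<le> fls_subdegree (F b)" if "b \<in> B" for b
      proof -
        have "nat (- fls_subdegree (F b)) \<le> Max ?S" using B(1) that by (intro Max_ge) auto
        then show ?thesis by linarith
      qed
    qed
    have "M 0 = lincomb W (\<lambda>b. \<Sum>j\<le>N. fps_nth A j * fls_nth (F b) (- int j)) B"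
      unfolding M_def using B(2) N(1) by (intro lincomb_cong fps_to_fls_times_nth_0) auto
    \<comment> \<open>The bound grows from \<open>n\<close> to \<open>N\<close>. At \<open>n\<close>
      only the last term survives, because \<open>A\<close> vanishes below \<open>n\<close>; each
      further term carries a coefficient \<open>L\<close> beyond the pole order.\<close>
    also have "\<dots> = fps_nth A n \<odot> L (- int n)"
      using N(2)
    proof (induction N rule: dec_induct)
      case base
      have "(\<Sum>j\<le>n. fps_nth A j * x j) = fps_nth A n * x n" for x
        using A by (simp add: lessThan_Suc_atMost[symmetric])
      then show ?case using B by (simp add: lincomb_smult)
    next
      case (step k)
      have "L (- int (Suc k)) = \<zero>" using step.hyps by (intro L) simp
      moreover have "L (- int n) \<in> carrier W" using B(2,5) by simp
      ultimately show ?case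
        using step.IH B(5) by (simp add: lincomb_add[OF B(2)] lincomb_smult[OF B(1,2)] del: of_nat_Suc)
    qed
    finally show ?thesis .
  qed
  ultimately show ?thesis by blast
qed

text \<open>Holomorphy is stated on a full neighbourhood, including \<open>s0\<close>. This is what
  ties the actual value \<open>f s0\<close> to a Laurent coefficient.\<close>

lemma vec_holomorphic_at_imp_vec_laurent:
  assumes "vec_holomorphic_at W f s0"
  shows "\<exists>L. vec_laurent W f s0 L \<and> (\<forall>i<0. L i = \<zero>) \<and> L 0 = f s0"
proof -
  from assms obtain B c where B: "finite B" "B \<subseteq> carrier W" "\<forall>b\<in>B. c b analytic_on {s0}"
    "\<forall>\<^sub>F s in nhds s0. f s = lincomb W (\<lambda>b. c b s) B"
    unfolding vec_holomorphic_at_def by blast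
  define F where "F b = fps_to_fls (fps_expansion (c b) s0)" for b
  define L where "L i = lincomb W (\<lambda>b. fls_nth (F b) i) B" for i
  have "vec_laurent W f s0 L"
    unfolding vec_laurent_def
  proof (intro exI[of _ B] exI[of _ c] exI[of _ F] conjI)
    show "\<forall>b\<in>B. (\<lambda>z. c b (s0 + z)) has_laurent_expansion F b"
      using B(3) unfolding F_def
      by (auto intro: has_laurent_expansion_fps analytic_at_imp_has_fps_expansion)
    show "\<forall>\<^sub>F s in at s0. f s = lincomb W (\<lambda>b. c b s) B"
      using B(4) by (auto simp: eventually_at_filter elim: eventually_mono)
  qed (use B(1,2) L_def in auto)
  moreover have "L i = \<zero>" if "i < 0" for i
    unfolding L_def using B(2) that by (intro lincomb_zero) (auto simp: F_def)
  moreover have "L 0 = f s0"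
  proof -
    have "f s0 = lincomb W (\<lambda>b. c b s0) B"
      using B(4) by (rule eventually_nhds_x_imp_x)
    then show ?thesis by (simp add: L_def F_def fps_expansion_def)
  qed
  ultimately show ?thesis by blast
qed

end

section \<open>Representations and splittings\<close>

locale representation = G: group G + V: complex_module V
  for G :: "('g, 'm) monoid_scheme" and V :: "('g, 'v) rep" +
  assumes group_rep: "group_rep G V"
begin

lemma linear_map_act: "g \<in> carrier G \<Longrightarrow> linear_map V V (act V g)"
  using group_rep by (simp add: group_rep_def)

lemma act_closed [simp]: "g \<in> carrier G \<Longrightarrow> x \<in> carrier V \<Longrightarrow> act V g x \<in> carrier V"
  using linear_map_act[of g] by (auto simp: linear_map_def)

lemma act_add:
  "g \<in> carrier G \<Longrightarrow> x \<in> carrier V \<Longrightarrow> y \<in> carrier V \<Longrightarrow>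
     act V g (x \<oplus>\<^bsub>V\<^esub> y) = act V g x \<oplus>\<^bsub>V\<^esub> act V g y"
  using linear_map_act by (simp add: linear_map_def)

lemma act_smult:
  "g \<in> carrier G \<Longrightarrow> x \<in> carrier V \<Longrightarrow> act V g (c \<odot>\<^bsub>V\<^esub> x) = c \<odot>\<^bsub>V\<^esub> act V g x"
  using linear_map_act by (simp add: linear_map_def)

lemma act_one [simp]: "x \<in> carrier V \<Longrightarrow> act V \<one>\<^bsub>G\<^esub> x = x"
  using group_rep by (simp add: group_rep_def)

lemma act_mult:
  "g \<in> carrier G \<Longrightarrow> h \<in> carrier G \<Longrightarrow> x \<in> carrier V \<Longrightarrow>
     act V (g \<otimes>\<^bsub>G\<^esub> h) x = act V g (act V h x)"
  using group_rep by (simp add: group_rep_def)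

lemma act_zero [simp]: "g \<in> carrier G \<Longrightarrow> act V g \<zero>\<^bsub>V\<^esub> = \<zero>\<^bsub>V\<^esub>"
  using linear_map_zero[OF V.module_axioms V.module_axioms linear_map_act] .

lemma act_diff:
  "g \<in> carrier G \<Longrightarrow> x \<in> carrier V \<Longrightarrow> y \<in> carrier V \<Longrightarrow>
     act V g (x \<ominus>\<^bsub>V\<^esub> y) = act V g x \<ominus>\<^bsub>V\<^esub> act V g y"
  using linear_map_diff[OF V.module_axioms V.module_axioms linear_map_act] .

lemma act_inv_cancel [simp]:
  "g \<in> carrier G \<Longrightarrow> x \<in> carrier V \<Longrightarrow> act V g (act V (inv\<^bsub>G\<^esub> g) x) = x"
  "g \<in> carrier G \<Longrightarrow> x \<in> carrier V \<Longrightarrow> act V (inv\<^bsub>G\<^esub> g) (act V g x) = x"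
  by (simp_all flip: act_mult)

lemma inj_on_act: "g \<in> carrier G \<Longrightarrow> inj_on (act V g) (carrier V)"
  by (metis act_inv_cancel(2) inj_onI)

end

lemma representationI: "group G \<Longrightarrow> group_rep G V \<Longrightarrow> representation G V"
  by (simp add: representation_def representation_axioms_def complex_module_def group_rep_def)

section \<open>Intertwiners, surjective images and quotient representations\<close>

lemma intertwiner_linear: "intertwiner G A B f \<Longrightarrow> linear_map A B f"
  by (simp add: intertwiner_def)

lemma intertwiner_closed: "intertwiner G A B f \<Longrightarrow> x \<in> carrier A \<Longrightarrow> f x \<in> carrier B"
  by (auto simp: intertwiner_def linear_map_def)

lemma intertwiner_comp:
  "intertwiner G A B f \<Longrightarrow> intertwiner G B C h \<Longrightarrow> intertwiner G A C (\<lambda>x. h (f x))"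
  by (auto simp: intertwiner_def linear_map_def Pi_def)

text \<open>Every element of \<open>Q\<close> is some \<open>p x\<close>, so each axiom is the image
  of the same axiom in \<open>A\<close>; this avoids computing with cosets. The condition on zero is
  separate because \<open>linear_map\<close> yields it only once \<open>Q\<close> is known to be a
  module.\<close>

lemma group_rep_surj_image:
  assumes "group G" "group_rep G A" "intertwiner G A Q p" "p ` carrier A = carrier Q"
    and zero: "p \<zero>\<^bsub>A\<^esub> = \<zero>\<^bsub>Q\<^esub>"
  shows "group_rep G Q"
proof -
  interpret A: representation G A using assms by (intro representationI)
  have p: "p x \<oplus>\<^bsub>Q\<^esub> p y = p (x \<oplus>\<^bsub>A\<^esub> y)" "c \<odot>\<^bsub>Q\<^esub> p x = p (c \<odot>\<^bsub>A\<^esub> x)"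
    if "x \<in> carrier A" "y \<in> carrier A" for x y c
    using assms(3) that by (auto simp: intertwiner_def linear_map_def)
  have p_closed: "p x \<in> carrier Q" if "x \<in> carrier A" for x
    using assms(3) that by (rule intertwiner_closed)
  have p_act: "act Q g (p x) = p (act A g x)" if "g \<in> carrier G" "x \<in> carrier A" for g x
    using assms(3) that by (simp add: intertwiner_def)
  have ball: "(\<forall>Z\<in>carrier Q. P Z) \<longleftrightarrow> (\<forall>x\<in>carrier A. P (p x))" for P
    using assms(4) by (metis (no_types, lifting) image_iff)
  have cases: "\<exists>x\<in>carrier A. Z = p x" if "Z \<in> carrier Q" for Z
    using that assms(4) by blast
  have "abelian_group Q"
  proof (rule abelian_groupI)
    show "\<zero>\<^bsub>Q\<^esub> \<in> carrier Q" by (simp flip: zero add: p_closed)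
    fix Z Y Z' assume ZYZ: "Z \<in> carrier Q" "Y \<in> carrier Q" "Z' \<in> carrier Q"
    obtain x y z where xyz: "x \<in> carrier A" "y \<in> carrier A" "z \<in> carrier A" "Z = p x" "Y = p y" "Z' = p z"
      using ZYZ[THEN cases] by blast
    show "Z \<oplus>\<^bsub>Q\<^esub> Y \<in> carrier Q" using xyz by (simp add: p p_closed)
    show "Z \<oplus>\<^bsub>Q\<^esub> Y \<oplus>\<^bsub>Q\<^esub> Z' = Z \<oplus>\<^bsub>Q\<^esub> (Y \<oplus>\<^bsub>Q\<^esub> Z')"
      using xyz by (simp add: p A.V.M.a_assoc)
    show "Z \<oplus>\<^bsub>Q\<^esub> Y = Y \<oplus>\<^bsub>Q\<^esub> Z" using xyz by (simp add: p A.V.M.a_comm)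
    show "\<zero>\<^bsub>Q\<^esub> \<oplus>\<^bsub>Q\<^esub> Z = Z" using xyz by (simp flip: zero add: p)
    show "\<exists>Y\<in>carrier Q. Y \<oplus>\<^bsub>Q\<^esub> Z = \<zero>\<^bsub>Q\<^esub>"
      using xyz by (intro bexI[of _ "p (\<ominus>\<^bsub>A\<^esub> x)"]) (simp_all flip: zero add: p A.V.M.l_neg p_closed)
  qed
  then have "Module.module complex_field Q"
  proof (rule moduleI[OF cring_from_type_algebra])
    fix a b :: complex and Z Y assume XY: "Z \<in> carrier Q" "Y \<in> carrier Q"
    obtain x y where xy: "x \<in> carrier A" "y \<in> carrier A" "Z = p x" "Y = p y"
      using XY[THEN cases] by blast
    show "a \<odot>\<^bsub>Q\<^esub> (Z \<oplus>\<^bsub>Q\<^esub> Y) = a \<odot>\<^bsub>Q\<^esub> Z \<oplus>\<^bsub>Q\<^esub> a \<odot>\<^bsub>Q\<^esub> Y"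
      using xy by (simp add: p A.V.smult_add_right)
  next
    fix a b :: complex and Z assume Z: "Z \<in> carrier Q"
    obtain x where x: "x \<in> carrier A" "Z = p x" using cases[OF Z] by blast
    show "a \<odot>\<^bsub>Q\<^esub> Z \<in> carrier Q" "\<one>\<^bsub>complex_field\<^esub> \<odot>\<^bsub>Q\<^esub> Z = Z"
      "(a \<oplus>\<^bsub>complex_field\<^esub> b) \<odot>\<^bsub>Q\<^esub> Z = a \<odot>\<^bsub>Q\<^esub> Z \<oplus>\<^bsub>Q\<^esub> b \<odot>\<^bsub>Q\<^esub> Z"
      "(a \<otimes>\<^bsub>complex_field\<^esub> b) \<odot>\<^bsub>Q\<^esub> Z = a \<odot>\<^bsub>Q\<^esub> (b \<odot>\<^bsub>Q\<^esub> Z)"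
      using x by (simp_all add: p p_closed A.V.smult_add_left A.V.smult_mult)
  qed
  then show ?thesis
    unfolding group_rep_def linear_map_def ball Pi_iff
    by (simp add: p p_closed p_act A.act_add A.act_smult A.act_mult)
qed

lemma smooth_rep_surj_image:
  assumes "group G" "smooth_rep G T A" "intertwiner G A Q p" "p ` carrier A = carrier Q"
    and "p \<zero>\<^bsub>A\<^esub> = \<zero>\<^bsub>Q\<^esub>"
  shows "smooth_rep G T Q"
proof -
  have "\<exists>K. open_subgroup G T K \<and> (\<forall>k\<in>K. act Q k Z = Z)" if Z: "Z \<in> carrier Q" for Z
  proof -
    obtain x where x: "x \<in> carrier A" "Z = p x" using Z assms(4) by (metis imageE)
    obtain K where K: "open_subgroup G T K" "\<forall>k\<in>K. act A k x = x"
      using assms(2) x(1) by (auto simp: smooth_rep_def)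
    have "act Q k Z = Z" if "k \<in> K" for k
      using K assms(3) that x subgroup.subset[of K G]
      by (auto simp: open_subgroup_def intertwiner_def) (metis subsetD)
    with K(1) show ?thesis by blast
  qed
  with group_rep_surj_image[OF assms(1) _ assms(3-5)] assms(2) show ?thesis
    by (simp add: smooth_rep_def)
qed

locale quotient_representation = representation G V
  for G :: "('g, 'm) monoid_scheme" and V :: "('g, 'v) rep" +
  fixes U :: "'v set"
  assumes subrep: "subrep G V U"
begin

lemma submodule: "submodule U complex_field V"
  using subrep by (simp add: subrep_def)

lemma sub_act: "g \<in> carrier G \<Longrightarrow> u \<in> U \<Longrightarrow> act V g u \<in> U"
  using subrep by (simp add: subrep_def)

lemmas sub_carrier = V.submoduleE(1)[OF submodule]

lemma sub_smult: "u \<in> U \<Longrightarrow> c \<odot>\<^bsub>V\<^esub> u \<in> U"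
  using V.submoduleE(4)[OF submodule] by simp

sublocale S: abelian_subgroup U V
  using submodule V.M.abelian_group_axioms
  by (intro abelian_subgroupI3 additive_subgroup.intro) (auto simp: submodule_def)

lemma coset_eqI: "u \<in> U \<Longrightarrow> x \<in> carrier V \<Longrightarrow> U +>\<^bsub>V\<^esub> (u \<oplus>\<^bsub>V\<^esub> x) = U +>\<^bsub>V\<^esub> x"
  by (rule S.a_repr_independence'[symmetric]) (auto simp: a_r_coset_def')

text \<open>\<open>quot_rep\<close> defines scalar multiplication and the group action as unions
  over all representatives of a coset. Such a union is a single coset, since the images of two
  representatives differ by an element of \<open>U\<close>.\<close>

lemma UN_coset:
  assumes "x \<in> carrier V"
    and "\<And>u. u \<in> U \<Longrightarrow> h (u \<oplus>\<^bsub>V\<^esub> x) = h' u \<oplus>\<^bsub>V\<^esub> h x" "\<And>u. u \<in> U \<Longrightarrow> h' u \<in> U"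
    and "h x \<in> carrier V"
  shows "(\<Union>y\<in>U +>\<^bsub>V\<^esub> x. U +>\<^bsub>V\<^esub> h y) = U +>\<^bsub>V\<^esub> h x"
proof -
  have "U +>\<^bsub>V\<^esub> h y = U +>\<^bsub>V\<^esub> h x" if y: "y \<in> U +>\<^bsub>V\<^esub> x" for y
  proof -
    obtain u where "u \<in> U" "y = u \<oplus>\<^bsub>V\<^esub> x" using y by (auto simp: a_r_coset_def')
    then show ?thesis using coset_eqI[OF assms(3,4)] assms(2) by metis
  qed
  moreover have "x \<in> U +>\<^bsub>V\<^esub> x" by (rule S.a_rcos_self) fact
  ultimately show ?thesis by (intro SUP_eq_const) blast+
qed

lemma intertwiner_coset: "intertwiner G V (quot_rep V U) (\<lambda>v. U +>\<^bsub>V\<^esub> v)"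
  unfolding intertwiner_def linear_map_def
proof (intro conjI ballI allI)
  show "(\<lambda>v. U +>\<^bsub>V\<^esub> v) \<in> carrier V \<rightarrow> carrier (quot_rep V U)"
    using sub_carrier by (auto simp: quot_rep_def intro: V.M.a_rcosetsI)
  show "U +>\<^bsub>V\<^esub> (x \<oplus>\<^bsub>V\<^esub> y) = (U +>\<^bsub>V\<^esub> x) \<oplus>\<^bsub>quot_rep V U\<^esub> (U +>\<^bsub>V\<^esub> y)"
    if "x \<in> carrier V" "y \<in> carrier V" for x y
    using S.a_rcos_sum[OF that] by (simp add: quot_rep_def)
  show "U +>\<^bsub>V\<^esub> (c \<odot>\<^bsub>V\<^esub> x) = c \<odot>\<^bsub>quot_rep V U\<^esub> (U +>\<^bsub>V\<^esub> x)" if "x \<in> carrier V" for c x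
    using UN_coset[of x "\<lambda>x. c \<odot>\<^bsub>V\<^esub> x" "\<lambda>x. c \<odot>\<^bsub>V\<^esub> x"] that sub_carrier
    by (simp add: quot_rep_def sub_smult subsetD V.smult_add_right)
  show "U +>\<^bsub>V\<^esub> act V g x = act (quot_rep V U) g (U +>\<^bsub>V\<^esub> x)"
    if "g \<in> carrier G" "x \<in> carrier V" for g x
    using UN_coset[of x "act V g" "act V g"] that sub_carrier
    by (simp add: quot_rep_def sub_act subsetD act_add)
qed

lemma coset_image: "(\<lambda>v. U +>\<^bsub>V\<^esub> v) ` carrier V = carrier (quot_rep V U)"
  by (auto simp: quot_rep_def A_RCOSETS_def')

lemma coset_cases:
  assumes "Z \<in> carrier (quot_rep V U)"
  obtains v where "v \<in> carrier V" "Z = U +>\<^bsub>V\<^esub> v"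
  using assms by (auto simp: quot_rep_def A_RCOSETS_def')

lemma coset_zero: "U +>\<^bsub>V\<^esub> \<zero>\<^bsub>V\<^esub> = \<zero>\<^bsub>quot_rep V U\<^esub>"
  using sub_carrier by (simp add: quot_rep_def)

lemma group_rep_quot: "group_rep G (quot_rep V U)"
  using group_rep_surj_image[OF G.group_axioms group_rep intertwiner_coset coset_image coset_zero] .

lemma smooth_rep_quot: "smooth_rep G T V \<Longrightarrow> smooth_rep G T (quot_rep V U)"
  using smooth_rep_surj_image[OF G.group_axioms _ intertwiner_coset coset_image coset_zero] .

lemma linear_map_descend:
  assumes "Module.module complex_field W" "linear_map V W f" "\<And>u. u \<in> U \<Longrightarrow> f u = \<zero>\<^bsub>W\<^esub>"
  obtains h where "h \<in> extensional (carrier (quot_rep V U))" "linear_map (quot_rep V U) W h"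
    "\<And>v. v \<in> carrier V \<Longrightarrow> h (U +>\<^bsub>V\<^esub> v) = f v"
proof -
  interpret W: complex_module W by (rule complex_module.intro) fact
  let ?p = "\<lambda>v. U +>\<^bsub>V\<^esub> v" and ?Q = "quot_rep V U"
  \<comment> \<open>Any representative will do, as \<open>f\<close> is constant on cosets; the
    restriction makes \<open>h\<close> extensional, as membership in \<open>Hom_rep\<close>
    requires.\<close>
  define h where "h = (\<lambda>Z\<in>carrier ?Q. f (SOME v. v \<in> Z))"
  have h: "h (?p v) = f v" if v: "v \<in> carrier V" for v
  proof -
    have "(SOME y. y \<in> ?p v) \<in> ?p v"
      using S.a_rcos_self[OF v] by (rule someI)
    then obtain u where "u \<in> U" "(SOME y. y \<in> ?p v) = u \<oplus>\<^bsub>V\<^esub> v"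
      by (auto simp: a_r_coset_def')
    moreover have "f (u \<oplus>\<^bsub>V\<^esub> v) = f v" if "u \<in> U" for u
      using assms(2,3) that v sub_carrier by (auto simp: linear_map_def Pi_iff subsetD)
    ultimately show ?thesis
      using intertwiner_closed[OF intertwiner_coset v] by (simp add: h_def)
  qed
  have "linear_map ?Q W h"
    unfolding linear_map_def Pi_iff
  proof (intro conjI ballI allI)
    fix Z Y c assume "Z \<in> carrier ?Q" "Y \<in> carrier ?Q"
    then obtain x y where xy: "x \<in> carrier V" "y \<in> carrier V" "Z = ?p x" "Y = ?p y"
      by (elim coset_cases)
    then have "Z \<oplus>\<^bsub>?Q\<^esub> Y = ?p (x \<oplus>\<^bsub>V\<^esub> y)"
      using intertwiner_coset by (simp add: intertwiner_def linear_map_def)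
    with xy assms(2) show "h (Z \<oplus>\<^bsub>?Q\<^esub> Y) = h Z \<oplus>\<^bsub>W\<^esub> h Y"
      by (simp add: linear_map_def h)
  next
    fix Z and c :: complex assume "Z \<in> carrier ?Q"
    then obtain x where x: "x \<in> carrier V" "Z = ?p x"
      by (elim coset_cases)
    then show "h Z \<in> carrier W" using assms(2) by (auto simp: h linear_map_def)
    from x have "c \<odot>\<^bsub>?Q\<^esub> Z = ?p (c \<odot>\<^bsub>V\<^esub> x)"
      using intertwiner_coset by (simp add: intertwiner_def linear_map_def)
    with x assms(2) show "h (c \<odot>\<^bsub>?Q\<^esub> Z) = c \<odot>\<^bsub>W\<^esub> h Z"
      by (simp add: linear_map_def h)
  qed
  moreover have "h \<in> extensional (carrier ?Q)" by (simp add: h_def)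
  ultimately show thesis using h that by blast
qed

end

section \<open>Direct sums and the split extension\<close>

lemma dsum_rep_simps [simp]:
  "carrier (dsum_rep A B) = carrier A \<times> carrier B"
  "\<zero>\<^bsub>dsum_rep A B\<^esub> = (\<zero>\<^bsub>A\<^esub>, \<zero>\<^bsub>B\<^esub>)"
  "(a, b) \<oplus>\<^bsub>dsum_rep A B\<^esub> (a', b') = (a \<oplus>\<^bsub>A\<^esub> a', b \<oplus>\<^bsub>B\<^esub> b')"
  "c \<odot>\<^bsub>dsum_rep A B\<^esub> (a, b) = (c \<odot>\<^bsub>A\<^esub> a, c \<odot>\<^bsub>B\<^esub> b)"
  "act (dsum_rep A B) g (a, b) = (act A g a, act B g b)"
  by (simp_all add: dsum_rep_def)

lemma group_rep_dsum:
  assumes "group G" "group_rep G A" "group_rep G B"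
  shows "group_rep G (dsum_rep A B)"
proof -
  interpret A: representation G A using assms by (intro representationI)
  interpret B: representation G B using assms by (intro representationI)
  have "abelian_group (dsum_rep A B)"
  proof (rule abelian_groupI)
    fix Z assume "Z \<in> carrier (dsum_rep A B)"
    then show "\<exists>Y\<in>carrier (dsum_rep A B). Y \<oplus>\<^bsub>dsum_rep A B\<^esub> Z = \<zero>\<^bsub>dsum_rep A B\<^esub>"
      by (intro bexI[of _ "(\<ominus>\<^bsub>A\<^esub> fst Z, \<ominus>\<^bsub>B\<^esub> snd Z)"]) (auto simp: A.V.M.l_neg B.V.M.l_neg)
  qed (auto simp: A.V.M.a_ac B.V.M.a_ac)
  then have "Module.module complex_field (dsum_rep A B)"
    by (rule moduleI[OF cring_from_type_algebra])
      (auto simp: A.V.smult_add_left A.V.smult_add_right A.V.smult_mult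
         B.V.smult_add_left B.V.smult_add_right B.V.smult_mult)
  then show ?thesis
    by (auto simp: group_rep_def linear_map_def A.act_add A.act_smult A.act_mult
        B.act_add B.act_smult B.act_mult)
qed

lemma smooth_rep_dsum:
  assumes "group G" "smooth_rep G T A" "smooth_rep G T B"
  shows "smooth_rep G T (dsum_rep A B)"
proof -
  have "\<exists>K. open_subgroup G T K \<and> (\<forall>k\<in>K. act (dsum_rep A B) k x = x)"
    if "x \<in> carrier (dsum_rep A B)" for x
  proof -
    obtain a b where x: "x = (a, b)" "a \<in> carrier A" "b \<in> carrier B"
      using \<open>x \<in> carrier (dsum_rep A B)\<close> by auto
    obtain K where K: "open_subgroup G T K" "\<forall>k\<in>K. act A k a = a"
      using assms(2) x(2) by (auto simp: smooth_rep_def)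
    obtain L where L: "open_subgroup G T L" "\<forall>k\<in>L. act B k b = b"
      using assms(3) x(3) by (auto simp: smooth_rep_def)
    have "open_subgroup G T (K \<inter> L)"
      using K(1) L(1) group.subgroups_Inter_pair[OF assms(1)]
      by (auto simp: open_subgroup_def)
    with K(2) L(2) x(1) show ?thesis by (intro exI[of _ "K \<inter> L"]) simp
  qed
  with group_rep_dsum assms show ?thesis by (auto simp: smooth_rep_def)
qed

lemma is_extension_dsum:
  assumes "group G" "smooth_rep G T A" "smooth_rep G T W"
  shows "is_extension G T A W (dsum_rep W A, \<lambda>w. (w, \<zero>\<^bsub>A\<^esub>), snd)"
proof -
  interpret A: representation G A
    using assms by (intro representationI) (auto simp: smooth_rep_def)
  interpret W: representation G W
    using assms by (intro representationI) (auto simp: smooth_rep_def)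
  show ?thesis
    using smooth_rep_dsum[OF assms(1,3,2)]
    by (auto simp: is_extension_def intertwiner_def linear_map_def inj_on_def a_kernel_def'
        intro: image_eqI[of _ snd "(\<zero>\<^bsub>W\<^esub>, _)"])
qed

text \<open>The identity is an equivalence of the split extension with itself. Having a concrete
  member of the zero class is what turns an equality of classes into a splitting.\<close>

lemma dsum_in_Ext1_zero:
  fixes A :: "('g, 'a) rep" and W :: "('g, 'w) rep"
  assumes "group G" "smooth_rep G T A" "smooth_rep G T W"
  shows "(dsum_rep W A, \<lambda>w. (w, \<zero>\<^bsub>A\<^esub>), snd) \<in> Ext1_zero G T A W"
proof -
  have "extn_equiv G W Z Z" for Z :: "('g, 'a, 'w, 'w \<times> 'a) extn"
    by (cases Z)
      (simp add: extn_equiv_def, rule exI[of _ "\<lambda>x. x"],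
       auto simp: intertwiner_def linear_map_def bij_betw_def)
  with is_extension_dsum[OF assms] show ?thesis
    by (simp add: Ext1_zero_def extn_class_def)
qed

section \<open>Pushouts along an intertwiner defined on a subrepresentation\<close>

context quotient_representation
begin

text \<open>\<open>U\<close> is a subset and not a representation of its own, so being an
  intertwiner on \<open>U\<close> is spelled out elementwise. The result makes the middle term of
  the pushout an instance of the quotient construction.\<close>

lemma subrep_pushout_graph:
  assumes "group_rep G W" and f: "\<And>u. u \<in> U \<Longrightarrow> f u \<in> carrier W"
    "\<And>u u'. u \<in> U \<Longrightarrow> u' \<in> U \<Longrightarrow> f (u \<oplus>\<^bsub>V\<^esub> u') = f u \<oplus>\<^bsub>W\<^esub> f u'"
    "\<And>c u. u \<in> U \<Longrightarrow> f (c \<odot>\<^bsub>V\<^esub> u) = c \<odot>\<^bsub>W\<^esub> f u"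
    "\<And>g u. g \<in> carrier G \<Longrightarrow> u \<in> U \<Longrightarrow> f (act V g u) = act W g (f u)"
  shows "subrep G (dsum_rep W V) (pushout_graph V U f)"
proof -
  interpret W: representation G W using assms G.group_axioms by (intro representationI)
  interpret X: representation G "dsum_rep W V"
    using group_rep_dsum G.group_axioms assms(1) group_rep by (intro representationI)
  let ?X = "dsum_rep W V" and ?Y = "pushout_graph V U f"
  have graph: "(f u, \<ominus>\<^bsub>V\<^esub> u) \<in> ?Y" if "u \<in> U" for u
    using that by (simp add: pushout_graph_def)
  have U: "u \<in> carrier V" if "u \<in> U" for u using that sub_carrier by auto
  have smult: "c \<odot>\<^bsub>?X\<^esub> y \<in> ?Y" if "y \<in> ?Y" for c y
    using that graph[OF sub_smult] U
    by (auto simp: pushout_graph_def f V.smult_minus_right intro!: image_eqI[of _ _ "c \<odot>\<^bsub>V\<^esub> _"] sub_smult)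
  have sub: "?Y \<subseteq> carrier ?X" using f(1) U by (auto simp: pushout_graph_def)
  have "submodule ?Y complex_field ?X"
  proof (rule X.V.submoduleI)
    show "\<zero>\<^bsub>?X\<^esub> \<in> ?Y"
      using smult[OF graph[OF S.zero_closed], of 0] f(1) U by (auto simp: sub)
    show "a \<oplus>\<^bsub>?X\<^esub> b \<in> ?Y" if "a \<in> ?Y" "b \<in> ?Y" for a b
    proof -
      from that obtain u u' where u: "u \<in> U" "u' \<in> U"
          "a = (f u, \<ominus>\<^bsub>V\<^esub> u)" "b = (f u', \<ominus>\<^bsub>V\<^esub> u')"
        by (auto simp: pushout_graph_def)
      with graph[of "u \<oplus>\<^bsub>V\<^esub> u'"] U show ?thesis by (simp add: f V.M.minus_add)
    qed
    show "\<ominus>\<^bsub>?X\<^esub> a \<in> ?Y" if "a \<in> ?Y" for a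
      using smult[OF that, of "-1"] X.V.smult_minus_left[of a 1] that sub by auto
  qed (use smult sub in auto)
  moreover have "act ?X g y \<in> ?Y" if "g \<in> carrier G" "y \<in> ?Y" for g y
  proof -
    from that(2) obtain u where u: "u \<in> U" "y = (f u, \<ominus>\<^bsub>V\<^esub> u)" by (auto simp: pushout_graph_def)
    have "act V g (\<ominus>\<^bsub>V\<^esub> u) = \<ominus>\<^bsub>V\<^esub> act V g u"
      using linear_map_minus[OF V.module_axioms V.module_axioms linear_map_act[OF that(1)]] U u(1) by simp
    with graph[OF sub_act[OF that(1) u(1)]] that(1) u show ?thesis by (simp add: f)
  qed
  ultimately show ?thesis by (simp add: subrep_def)
qed

text \<open>
  A splitting \<open>\<phi>\<close> of the pushout restricts along \<open>V \<rightarrow> W \<oplus> V\<close> to an extension of \<open>f\<close>, because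
  \<open>(0, u)\<close> and \<open>(f u, 0)\<close> are congruent modulo the graph.
\<close>

lemma connecting_hom_eq_zero_imp_extends:
  assumes "smooth_rep G T V" "smooth_rep G T W" and f: "\<And>u. u \<in> U \<Longrightarrow> f u \<in> carrier W"
    "\<And>u u'. u \<in> U \<Longrightarrow> u' \<in> U \<Longrightarrow> f (u \<oplus>\<^bsub>V\<^esub> u') = f u \<oplus>\<^bsub>W\<^esub> f u'"
    "\<And>c u. u \<in> U \<Longrightarrow> f (c \<odot>\<^bsub>V\<^esub> u) = c \<odot>\<^bsub>W\<^esub> f u"
    "\<And>g u. g \<in> carrier G \<Longrightarrow> u \<in> U \<Longrightarrow> f (act V g u) = act W g (f u)"
    and "connecting_hom G T V U W f = Ext1_zero G T (quot_rep V U) W"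
  shows "\<exists>\<eta>. intertwiner G V W \<eta> \<and> (\<forall>u\<in>U. \<eta> u = f u)"
proof -
  let ?X = "dsum_rep W V" and ?Y = "pushout_graph V U f"
  have group_rep_W: "group_rep G W" using assms(2) by (simp add: smooth_rep_def)
  interpret W: representation G W using group_rep_W G.group_axioms by (intro representationI)
  interpret X: quotient_representation G ?X ?Y
    using representationI[OF G.group_axioms group_rep_dsum[OF G.group_axioms group_rep_W group_rep]]
      subrep_pushout_graph[OF group_rep_W f]
    by (intro quotient_representation.intro quotient_representation_axioms.intro)
  let ?p = "\<lambda>x. ?Y +>\<^bsub>?X\<^esub> x" and ?Q = "quot_rep V U"
  \<comment> \<open>The zero class contains the split extension, hence so does the class of the
    pushout; \<phi> is the equivalence that this membership provides.\<close>
  have "(dsum_rep W ?Q, \<lambda>w. (w, \<zero>\<^bsub>?Q\<^esub>), snd) \<in> connecting_hom G T V U W f"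
    using dsum_in_Ext1_zero[OF G.group_axioms smooth_rep_quot[OF assms(1)] assms(2)] assms(7) by simp
  then obtain \<phi> where \<phi>: "intertwiner G (quot_rep ?X ?Y) (dsum_rep W ?Q) \<phi>"
      "\<And>w. w \<in> carrier W \<Longrightarrow> \<phi> (?p (w, \<zero>\<^bsub>V\<^esub>)) = (w, \<zero>\<^bsub>?Q\<^esub>)"
    by (auto simp: connecting_hom_def extn_class_def extn_equiv_def pushout_extn_def)
  have "intertwiner G V ?X (\<lambda>v. (\<zero>\<^bsub>W\<^esub>, v))" "intertwiner G (dsum_rep W ?Q) W fst"
    by (auto simp: intertwiner_def linear_map_def)
  \<comment> \<open>The composite V -> W \<oplus> V -> pushout -> W \<oplus> V/U -> W, with \<phi>
    in the third place.\<close>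
  then have "intertwiner G V W (\<lambda>v. fst (\<phi> (?p (\<zero>\<^bsub>W\<^esub>, v))))"
    using X.intertwiner_coset \<phi>(1) intertwiner_comp by metis
  moreover have "fst (\<phi> (?p (\<zero>\<^bsub>W\<^esub>, u))) = f u" if u: "u \<in> U" for u
  proof -
    have "u \<in> carrier V" using u sub_carrier by auto
    moreover have "(f u, \<ominus>\<^bsub>V\<^esub> u) \<in> ?Y" using u by (simp add: pushout_graph_def)
    ultimately have "?p (f u, \<zero>\<^bsub>V\<^esub>) = ?p (\<zero>\<^bsub>W\<^esub>, u)"
      using X.coset_eqI[of "(f u, \<ominus>\<^bsub>V\<^esub> u)" "(\<zero>\<^bsub>W\<^esub>, u)"] f(1)[OF u] by (simp add: V.M.l_neg)
    with \<phi>(2)[OF f(1)[OF u]] show ?thesis by simp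
  qed
  ultimately show ?thesis by blast
qed

end

section \<open>Products of augmentation elements on spaces of homomorphisms\<close>

lemma Hom_rep_simps [simp]:
  "f \<in> carrier (Hom_rep G A W) \<longleftrightarrow> f \<in> extensional (carrier A) \<and> linear_map A W f"
  "\<zero>\<^bsub>Hom_rep G A W\<^esub> = (\<lambda>a\<in>carrier A. \<zero>\<^bsub>W\<^esub>)"
  "f \<oplus>\<^bsub>Hom_rep G A W\<^esub> h = (\<lambda>a\<in>carrier A. f a \<oplus>\<^bsub>W\<^esub> h a)"
  "act (Hom_rep G A W) g f = (\<lambda>a\<in>carrier A. act W g (f (act A (inv\<^bsub>G\<^esub> g) a)))"
  by (simp_all add: Hom_rep_def)

text \<open>
  The pointwise counterpart of \<open>aug_prod (Hom_rep G A W)\<close>; it applies to functions that need be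
  neither linear nor extensional.
\<close>

primrec aug_fun ::
    "('g, 'm) monoid_scheme \<Rightarrow> ('g, 'a) rep \<Rightarrow> ('g, 'w) rep \<Rightarrow> 'g list \<Rightarrow> ('a \<Rightarrow> 'w) \<Rightarrow> 'a \<Rightarrow> 'w"
  where
  "aug_fun G A W [] f = f"
| "aug_fun G A W (g # gs) f =
     (\<lambda>a. act W g (aug_fun G A W gs f (act A (inv\<^bsub>G\<^esub> g) a)) \<ominus>\<^bsub>W\<^esub> aug_fun G A W gs f a)"

section \<open>The additive group Hom(A, W) and augmentation products\<close>

locale representation_pair = A: representation G A + W: representation G W
  for G :: "('g, 'm) monoid_scheme" and A :: "('g, 'a) rep" and W :: "('g, 'w) rep"
begin

lemma linear_map_uminus:
  assumes "linear_map A W f"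
  shows "linear_map A W (\<lambda>a\<in>carrier A. \<ominus>\<^bsub>W\<^esub> f a)"
  using assms
  by (auto simp: linear_map_def Pi_iff W.V.M.minus_add W.V.M.a_comm W.V.smult_minus_right)

text \<open>\<open>aug_prod\<close> subtracts through the additive inverse of the record, which is
  given by a description. The group axioms are needed before that inverse can be identified with
  pointwise negation.\<close>

lemma abelian_group_Hom_rep: "abelian_group (Hom_rep G A W)"
proof (rule abelian_groupI)
  let ?H = "Hom_rep G A W"
  show "\<zero>\<^bsub>?H\<^esub> \<in> carrier ?H" by (simp add: linear_map_def)
  fix f h k assume fhk: "f \<in> carrier ?H" "h \<in> carrier ?H" "k \<in> carrier ?H"
  then have closed: "f a \<in> carrier W" "h a \<in> carrier W" "k a \<in> carrier W" if "a \<in> carrier A" for a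
    using that by (auto simp: linear_map_def)
  show "f \<oplus>\<^bsub>?H\<^esub> h \<in> carrier ?H"
    using fhk closed by (auto simp: linear_map_def W.V.M.a_ac W.V.smult_add_right)
  show "f \<oplus>\<^bsub>?H\<^esub> h \<oplus>\<^bsub>?H\<^esub> k = f \<oplus>\<^bsub>?H\<^esub> (h \<oplus>\<^bsub>?H\<^esub> k)"
    using closed by (auto simp: W.V.M.a_assoc intro!: restrict_ext)
  show "f \<oplus>\<^bsub>?H\<^esub> h = h \<oplus>\<^bsub>?H\<^esub> f"
    using closed by (auto simp: W.V.M.a_comm intro!: restrict_ext)
  show "\<zero>\<^bsub>?H\<^esub> \<oplus>\<^bsub>?H\<^esub> f = f"
    using closed fhk(1) by (auto intro!: extensionalityI[of _ "carrier A"])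
  show "\<exists>h\<in>carrier ?H. h \<oplus>\<^bsub>?H\<^esub> f = \<zero>\<^bsub>?H\<^esub>"
    using closed fhk(1) linear_map_uminus
    by (intro bexI[of _ "\<lambda>a\<in>carrier A. \<ominus>\<^bsub>W\<^esub> f a"]) (auto simp: W.V.M.l_neg intro!: restrict_ext)
qed

lemma Hom_rep_diff:
  assumes "f \<in> carrier (Hom_rep G A W)" "h \<in> carrier (Hom_rep G A W)" "a \<in> carrier A"
  shows "(f \<ominus>\<^bsub>Hom_rep G A W\<^esub> h) a = f a \<ominus>\<^bsub>W\<^esub> h a"
proof -
  interpret H: abelian_group "Hom_rep G A W" by (rule abelian_group_Hom_rep)
  let ?m = "\<lambda>a\<in>carrier A. \<ominus>\<^bsub>W\<^esub> h a"
  have "?m \<oplus>\<^bsub>Hom_rep G A W\<^esub> h = \<zero>\<^bsub>Hom_rep G A W\<^esub>"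
    using assms(2) by (auto simp: linear_map_def Pi_iff W.V.M.l_neg intro!: restrict_ext)
  then have "\<ominus>\<^bsub>Hom_rep G A W\<^esub> h = ?m"
    using assms(2) linear_map_uminus by (intro H.minus_equality) auto
  then show ?thesis using assms(3) by (simp add: a_minus_def)
qed

lemma Hom_rep_act_closed:
  assumes "f \<in> carrier (Hom_rep G A W)" "g \<in> carrier G"
  shows "act (Hom_rep G A W) g f \<in> carrier (Hom_rep G A W)"
  using assms
  by (auto simp: linear_map_def Pi_iff A.act_add A.act_smult W.act_add W.act_smult)

text \<open>Membership is proved along with the formula because pointwise subtraction is available
  only for elements of the carrier.\<close>

lemma aug_prod_Hom_rep:
  assumes "f \<in> carrier (Hom_rep G A W)" "set gs \<subseteq> carrier G"
  shows "aug_prod (Hom_rep G A W) gs f \<in> carrier (Hom_rep G A W) \<and>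
         (\<forall>a\<in>carrier A. aug_prod (Hom_rep G A W) gs f a = aug_fun G A W gs f a)"
  using assms(2)
proof (induction gs)
  case Nil
  with assms(1) show ?case by (simp add: aug_prod_def)
next
  case (Cons g gs)
  interpret H: abelian_group "Hom_rep G A W" by (rule abelian_group_Hom_rep)
  let ?y = "aug_prod (Hom_rep G A W) gs f"
  have y: "?y \<in> carrier (Hom_rep G A W)" and g: "g \<in> carrier G" using Cons by auto
  have gy: "act (Hom_rep G A W) g ?y \<in> carrier (Hom_rep G A W)"
    by (rule Hom_rep_act_closed) (fact y g)+
  have step: "aug_prod (Hom_rep G A W) (g # gs) f = act (Hom_rep G A W) g ?y \<ominus>\<^bsub>Hom_rep G A W\<^esub> ?y"
    by (simp add: aug_prod_def)
  have "aug_prod (Hom_rep G A W) (g # gs) f a = aug_fun G A W (g # gs) f a" if a: "a \<in> carrier A" for a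
    using Hom_rep_diff[OF gy y a] Cons a by (simp add: step)
  with H.minus_closed[OF gy y] show ?case unfolding step by blast
qed

lemma aug_fun_closed:
  assumes "\<And>a. a \<in> carrier A \<Longrightarrow> f a \<in> carrier W" "set gs \<subseteq> carrier G" "a \<in> carrier A"
  shows "aug_fun G A W gs f a \<in> carrier W"
  using assms(2,3) by (induction gs arbitrary: a) (auto simp: assms(1))

lemma aug_fun_cong:
  assumes "\<And>a. a \<in> carrier A \<Longrightarrow> f a = h a" "set gs \<subseteq> carrier G" "a \<in> carrier A"
  shows "aug_fun G A W gs f a = aug_fun G A W gs h a"
  using assms(2,3) by (induction gs arbitrary: a) (auto simp: assms(1))

lemma aug_fun_diff:
  assumes "\<And>a. a \<in> carrier A \<Longrightarrow> f a \<in> carrier W" "\<And>a. a \<in> carrier A \<Longrightarrow> h a \<in> carrier W"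
    and "set gs \<subseteq> carrier G" "a \<in> carrier A"
  shows "aug_fun G A W gs (\<lambda>a. f a \<ominus>\<^bsub>W\<^esub> h a) a = aug_fun G A W gs f a \<ominus>\<^bsub>W\<^esub> aug_fun G A W gs h a"
  using assms(3,4)
proof (induction gs arbitrary: a)
  case (Cons g gs)
  have "(x \<ominus>\<^bsub>W\<^esub> y) \<ominus>\<^bsub>W\<^esub> (x' \<ominus>\<^bsub>W\<^esub> y') = (x \<ominus>\<^bsub>W\<^esub> x') \<ominus>\<^bsub>W\<^esub> (y \<ominus>\<^bsub>W\<^esub> y')"
    if "x \<in> carrier W" "y \<in> carrier W" "x' \<in> carrier W" "y' \<in> carrier W" for x y x' y'
    using that by (simp add: a_minus_def W.V.M.minus_add W.V.M.a_ac)
  with Cons show ?case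
    by (simp add: aug_fun_closed assms(1,2) W.act_diff)
qed simp

text \<open>The innermost factor already gives zero, an intertwiner being fixed by the action on
  Hom; the outer factors preserve zero. The empty product is the identity, hence
  \<open>gs \<noteq> []\<close>.\<close>

lemma aug_fun_intertwiner:
  assumes "intertwiner G A W \<eta>" "set gs \<subseteq> carrier G" "gs \<noteq> []" "a \<in> carrier A"
  shows "aug_fun G A W gs \<eta> a = \<zero>\<^bsub>W\<^esub>"
  using assms(2-4)
proof (induction gs arbitrary: a)
  case (Cons g gs)
  have diff_self: "x \<ominus>\<^bsub>W\<^esub> x = \<zero>\<^bsub>W\<^esub>" if "x \<in> carrier W" for x
    using that W.V.diff_eq_0_iff by blast
  show ?case
  proof (cases "gs = []")
    case True
    let ?b = "act A (inv\<^bsub>G\<^esub> g) a"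
    have "g \<in> carrier G" "?b \<in> carrier A" using Cons.prems by simp_all
    then have "\<eta> (act A g ?b) = act W g (\<eta> ?b)"
      using assms(1) unfolding intertwiner_def by blast
    then have "act W g (\<eta> ?b) = \<eta> a"
      using Cons.prems by simp
    with True Cons.prems(3) show ?thesis
      using intertwiner_closed[OF assms(1)] by (simp add: diff_self)
  next
    case False
    with Cons show ?thesis by (simp add: diff_self)
  qed
qed simp

text \<open>Equivariance at the point \<open>act A (inv g) a\<close> cancels the two actions on the
  argument and says that \<open>f\<close> is an eigenvector of \<open>g\<close> with eigenvalue
  \<open>\<omega> g\<close>, for the action on Hom.\<close>

lemma aug_fun_equivariant:
  assumes closed: "\<And>a. a \<in> carrier A \<Longrightarrow> f a \<in> carrier W"
    and equiv: "\<And>g a. g \<in> carrier G \<Longrightarrow> a \<in> carrier A \<Longrightarrow> act W g (f a) = \<omega> g \<odot>\<^bsub>W\<^esub> f (act A g a)"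
    and "set gs \<subseteq> carrier G" "a \<in> carrier A"
  shows "aug_fun G A W gs f a = (\<Prod>g\<leftarrow>gs. \<omega> g - 1) \<odot>\<^bsub>W\<^esub> f a"
  using assms(3,4)
proof (induction gs arbitrary: a)
  case Nil
  then show ?case by (simp add: closed)
next
  case (Cons g gs)
  let ?c = "\<Prod>g\<leftarrow>gs. \<omega> g - 1"
  have g: "g \<in> carrier G" using Cons.prems by simp
  have "act W g (?c \<odot>\<^bsub>W\<^esub> f (act A (inv\<^bsub>G\<^esub> g) a)) = (?c * \<omega> g) \<odot>\<^bsub>W\<^esub> f a"
    using g Cons.prems by (simp add: W.act_smult closed equiv W.V.smult_mult)
  then show ?case
    using g Cons W.V.smult_diff_left[OF closed[OF Cons.prems(2)], of "?c * \<omega> g" ?c]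
    by (simp add: algebra_simps)
qed

text \<open>The product involves only the argument \<open>a\<close> and the values in
  \<open>W\<close>, not s, so it passes to coefficients. Each factor also evaluates at
  \<open>act A (inv g) a\<close>, which is why expansions at all points of \<open>A\<close> are
  assumed.\<close>

lemma aug_fun_vec_laurent:
  assumes "\<And>a. a \<in> carrier A \<Longrightarrow> vec_laurent W (\<lambda>s. f s a) s0 (\<lambda>i. L i a)"
    and "set gs \<subseteq> carrier G" "a \<in> carrier A"
  shows "vec_laurent W (\<lambda>s. aug_fun G A W gs (f s) a) s0 (\<lambda>i. aug_fun G A W gs (L i) a)"
  using assms(2,3)
proof (induction gs arbitrary: a)
  case Nil
  then show ?case by (simp add: assms(1))
next
  case (Cons g gs)
  then have g: "g \<in> carrier G" by simp
  with Cons show ?case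
    by (simp add: W.V.vec_laurent_diff
        W.V.vec_laurent_linear_image[OF _ W.linear_map_act[OF g] W.inj_on_act[OF g]])
qed

text \<open>Near \<open>s0\<close> the same function has two expansions, one with the product
  applied coefficientwise and one with a scalar factor; their constant terms agree. The pole bound
  concerns the single vector \<open>a\<close>, so a short list may be used at a vector where the
  pole is mild, whatever happens elsewhere.\<close>

lemma aug_fun_laurent_coeff_0:
  assumes L: "\<And>a. a \<in> carrier A \<Longrightarrow> vec_laurent W (\<lambda>s. f s a) s0 (\<lambda>i. L i a)"
    and equiv: "\<forall>\<^sub>F s in at s0. (\<forall>a\<in>carrier A. f s a \<in> carrier W) \<and>
       (\<forall>g\<in>carrier G. \<forall>a\<in>carrier A. act W g (f s a) = \<omega> s g \<odot>\<^bsub>W\<^esub> f s (act A g a))"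
    and \<omega>: "\<And>g. g \<in> carrier G \<Longrightarrow> (\<lambda>s. \<omega> s g) analytic_on {s0}"
      "\<And>g. g \<in> carrier G \<Longrightarrow> \<omega> s0 g = 1"
    and gs: "set gs \<subseteq> carrier G" and a: "a \<in> carrier A"
    and order: "\<And>i. i < - int (length gs) \<Longrightarrow> L i a = \<zero>\<^bsub>W\<^esub>"
  shows "aug_fun G A W gs (L 0) a =
         (\<Prod>g\<leftarrow>gs. deriv (\<lambda>s. \<omega> s g) s0) \<odot>\<^bsub>W\<^esub> L (- int (length gs)) a"
proof -
  let ?c = "\<lambda>s. \<Prod>g\<leftarrow>gs. \<omega> s g - 1"
  have an: "(\<lambda>s. \<omega> s g - 1) analytic_on {s0}" if "g \<in> set gs" for g
    using \<omega>(1) gs that by (intro analytic_on_diff analytic_on_const) auto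
  then obtain Q where Q: "(\<lambda>z. ?c (s0 + z)) has_fps_expansion fps_X ^ length gs * Q"
      "fps_nth Q 0 = (\<Prod>g\<leftarrow>gs. deriv (\<lambda>s. \<omega> s g - 1) s0)"
    using has_fps_expansion_prod_list_simple_zeros[of gs "\<lambda>g s. \<omega> s g - 1" s0] \<omega>(2) gs by auto
  have "deriv (\<lambda>s. \<omega> s g - 1) s0 = deriv (\<lambda>s. \<omega> s g) s0" if "g \<in> set gs" for g
    using \<omega>(1)[of g] gs that by (subst deriv_diff) (auto simp: analytic_on_imp_differentiable_at)
  then have Q0: "fps_nth Q 0 = (\<Prod>g\<leftarrow>gs. deriv (\<lambda>s. \<omega> s g) s0)"
    unfolding Q(2) by (intro arg_cong[of _ _ prod_list] map_cong) auto
  obtain M where M: "vec_laurent W (\<lambda>s. ?c s \<odot>\<^bsub>W\<^esub> f s a) s0 M"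
      "M 0 = fps_nth (fps_X ^ length gs * Q) (length gs) \<odot>\<^bsub>W\<^esub> L (- int (length gs)) a"
    using W.V.vec_laurent_smult_nth_0[OF L[OF a] Q(1), of "length gs"] order
    by (auto simp: fps_X_power_mult_nth)
  \<comment> \<open>Equivariance is available only near \<open>s0\<close> and away from it, which is
    all that uniqueness of coefficients uses.\<close>
  have "\<forall>\<^sub>F s in at s0. aug_fun G A W gs (f s) a = ?c s \<odot>\<^bsub>W\<^esub> f s a"
    using equiv by eventually_elim (intro aug_fun_equivariant, use gs a in auto)
  moreover have "vec_laurent W (\<lambda>s. aug_fun G A W gs (f s) a) s0 (\<lambda>i. aug_fun G A W gs (L i) a)"
    using L gs a by (rule aug_fun_vec_laurent)
  ultimately have "aug_fun G A W gs (L 0) a = M 0"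
    using W.V.vec_laurent_unique M(1) by blast
  then show ?thesis
    by (simp add: M(2) Q0 fps_X_power_mult_nth)
qed

end

text \<open>Precomposition with \<open>p\<close> leaves the action on values alone and exchanges the
  actions on arguments. With \<open>p\<close> the projection to V/U it moves the computation to V,
  where the Laurent coefficients are defined.\<close>

lemma aug_fun_pullback:
  assumes "group G" "group_rep G A" "intertwiner G A Q p" "set gs \<subseteq> carrier G" "a \<in> carrier A"
  shows "aug_fun G Q W gs h (p a) = aug_fun G A W gs (\<lambda>a. h (p a)) a"
proof -
  interpret A: representation G A using assms by (intro representationI)
  have "act Q (inv\<^bsub>G\<^esub> g) (p a) = p (act A (inv\<^bsub>G\<^esub> g) a)" if "g \<in> carrier G" "a \<in> carrier A" for g a
    using assms(3) that by (simp add: intertwiner_def)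
  then show ?thesis
    using assms(4,5) by (induction gs arbitrary: a) auto
qed

section \<open>Non-vanishing of the connecting map at a pole\<close>

theorem theoremA10:
  fixes G :: "('g, 'm) monoid_scheme" and T :: "'g topology"
    and D :: "complex set" and \<omega> :: "complex \<Rightarrow> 'g \<Rightarrow> complex"
    and V :: "('g, 'v) rep" and W :: "('g, 'w) rep"
    and \<xi> :: "complex \<Rightarrow> 'v \<Rightarrow> 'w"
    and s0 :: complex and U :: "'v set" and k0 :: nat and gs :: "'g list"
  assumes "l_group G T"
    and "open D"
    and "holomorphic_character G T D \<omega>"
    and "smooth_rep G T V"
    and "admissible G T W"
    and "meromorphic_intertwiner G T D \<omega> V W \<xi>"
    and "s0 \<in> D"
    and "\<forall>g\<in>carrier G. \<omega> s0 g = 1"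
    and "subrep G V U"
    and "\<forall>u\<in>U. vec_holomorphic_at W (\<lambda>s. \<xi> s u) s0"
    and "has_pole_order V W \<xi> s0 k0"
    and "k0 \<ge> 1"
    and "length gs = k0" and "set gs \<subseteq> carrier G"
    and "\<forall>g\<in>set gs. deriv (\<lambda>s. \<omega> s g) s0 \<noteq> 0"
    and "\<forall>\<eta>\<in>Hom_Ginf G (quot_rep V U) W.
           aug_prod (Hom_rep G (quot_rep V U) W) gs \<eta> = \<zero>\<^bsub>Hom_rep G (quot_rep V U) W\<^esub>"
  shows "connecting_hom G T V U W (\<lambda>u\<in>U. \<xi> s0 u) \<noteq> Ext1_zero G T (quot_rep V U) W"
proof
  assume split: "connecting_hom G T V U W (\<lambda>u\<in>U. \<xi> s0 u) = Ext1_zero G T (quot_rep V U) W"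
  let ?Q = "quot_rep V U" and ?p = "\<lambda>v. U +>\<^bsub>V\<^esub> v"
  have group: "group G" using assms(1) by (simp add: l_group_def)
  have smooth_W: "smooth_rep G T W" using assms(5) by (simp add: admissible_def)
  interpret V: quotient_representation G V U
    using assms(4,9) group
    by (intro quotient_representation.intro quotient_representation_axioms.intro representationI)
      (auto simp: smooth_rep_def)
  interpret W: representation G W
    using group smooth_W by (intro representationI) (auto simp: smooth_rep_def)
  interpret Q: representation G ?Q
    by (rule representationI[OF group V.group_rep_quot])
  interpret VW: representation_pair G V W ..
  interpret QW: representation_pair G ?Q W ..

  obtain \<xi>c where lin: "\<And>i. linear_map V W (\<xi>c i)"
    and laurent: "\<And>v. v \<in> carrier V \<Longrightarrow> vec_laurent W (\<lambda>s. \<xi> s v) s0 (\<lambda>i. \<xi>c i v)"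
    and order: "\<And>i v. i < - int k0 \<Longrightarrow> v \<in> carrier V \<Longrightarrow> \<xi>c i v = \<zero>\<^bsub>W\<^esub>"
    and pole: "\<exists>v\<in>carrier V. \<xi>c (- int k0) v \<noteq> \<zero>\<^bsub>W\<^esub>"
    using assms(11) unfolding has_pole_order_def by blast
  have closed: "\<xi>c i v \<in> carrier W" if "v \<in> carrier V" for i v
    using lin[of i] that by (auto simp: linear_map_def)
  \<comment> \<open>The pole order and holomorphy at \<open>v\<close> each supply an expansion;
    uniqueness identifies them, so \<open>\<xi>c 0 v\<close> is the value at \<open>s0\<close> and
    the polar part vanishes.\<close>
  have holo: "\<xi>c 0 v = \<xi> s0 v" "\<And>i. i < 0 \<Longrightarrow> \<xi>c i v = \<zero>\<^bsub>W\<^esub>"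
    if v: "v \<in> carrier V" "vec_holomorphic_at W (\<lambda>s. \<xi> s v) s0" for v
  proof -
    obtain L where L: "vec_laurent W (\<lambda>s. \<xi> s v) s0 L" "\<forall>i<0. L i = \<zero>\<^bsub>W\<^esub>" "L 0 = \<xi> s0 v"
      using W.V.vec_holomorphic_at_imp_vec_laurent[OF v(2)] by blast
    have "\<xi>c i v = L i" for i
      using W.V.vec_laurent_unique[OF laurent[OF v(1)] L(1)] by simp
    with L show "\<xi>c 0 v = \<xi> s0 v" "\<And>i. i < 0 \<Longrightarrow> \<xi>c i v = \<zero>\<^bsub>W\<^esub>" by simp_all
  qed

  obtain P where P: "discrete P"
    and regular: "\<And>s. s \<in> D - P \<Longrightarrow> linear_map V W (\<xi> s) \<and>
       (\<forall>g\<in>carrier G. \<forall>v\<in>carrier V. act W g (\<xi> s v) = \<omega> s g \<odot>\<^bsub>W\<^esub> \<xi> s (act V g v)) \<and>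
       (\<forall>v\<in>carrier V. vec_holomorphic_at W (\<lambda>s. \<xi> s v) s)"
    using assms(6) unfolding meromorphic_intertwiner_def by meson
  \<comment> \<open>\<open>discrete\<close> does not make \<open>P\<close> closed in \<open>D\<close>; but \<open>s0\<close>, being a pole, lies in \<open>P\<close>.\<close>
  have "s0 \<in> P"
    using pole holo(2)[of _ "- int k0"] regular[of s0] assms(7,12) by force
  then obtain S where S: "open S" "S \<inter> P = {s0}"
    using P unfolding discrete_def isolated_in_def by blast
  then have "\<forall>\<^sub>F s in at s0. s \<in> S \<inter> D - {s0}"
    using assms(2,7) by (intro eventually_at_in_open) auto
  then have "\<forall>\<^sub>F s in at s0. s \<in> D - P"
    by eventually_elim (use S(2) in blast)
  then have equiv: "\<forall>\<^sub>F s in at s0. (\<forall>v\<in>carrier V. \<xi> s v \<in> carrier W) \<and>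
      (\<forall>g\<in>carrier G. \<forall>v\<in>carrier V. act W g (\<xi> s v) = \<omega> s g \<odot>\<^bsub>W\<^esub> \<xi> s (act V g v))"
    by eventually_elim (use regular in \<open>fastforce simp: linear_map_def\<close>)
  have analytic: "(\<lambda>s. \<omega> s g) analytic_on {s0}" if "g \<in> carrier G" for g
    using assms(2,3,7) that by (auto simp: holomorphic_character_def analytic_at)
  have aug: "aug_fun G V W hs (\<xi>c 0) v =
      (\<Prod>g\<leftarrow>hs. deriv (\<lambda>s. \<omega> s g) s0) \<odot>\<^bsub>W\<^esub> \<xi>c (- int (length hs)) v"
    if "set hs \<subseteq> carrier G" "v \<in> carrier V" "\<And>i. i < - int (length hs) \<Longrightarrow> \<xi>c i v = \<zero>\<^bsub>W\<^esub>" for hs v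
    by (rule VW.aug_fun_laurent_coeff_0[OF laurent equiv analytic _ that]) (use assms(8) in auto)

  have U: "u \<in> carrier V" if "u \<in> U" for u using that V.sub_carrier by auto
  have \<xi>_U: "\<xi> s0 u = \<xi>c 0 u" "\<xi>c (-1) u = \<zero>\<^bsub>W\<^esub>" "\<And>i. i < -1 \<Longrightarrow> \<xi>c i u = \<zero>\<^bsub>W\<^esub>" if "u \<in> U" for u
    using holo[OF U[OF that]] assms(10) that by simp_all
  \<comment> \<open>Equivariance cannot be evaluated at \<open>s0\<close>, which lies in
    \<open>P\<close>. It is obtained from the constant term for the list \<open>[g]\<close>, taken
    at \<open>act V g u\<close> so that the inverse in the action on Hom cancels.\<close>
  have \<xi>_act: "\<xi>c 0 (act V g u) = act W g (\<xi>c 0 u)" if g: "g \<in> carrier G" and u: "u \<in> U" for g u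
  proof -
    have gu: "act V g u \<in> U" using V.sub_act g u by simp
    then have "act W g (\<xi>c 0 u) \<ominus>\<^bsub>W\<^esub> \<xi>c 0 (act V g u) = \<zero>\<^bsub>W\<^esub>"
      using aug[of "[g]" "act V g u"] g \<xi>_U U u by simp
    then show ?thesis
      using W.V.diff_eq_0_iff closed g u gu U by (metis W.act_closed)
  qed
  have "\<exists>\<eta>. intertwiner G V W \<eta> \<and> (\<forall>u\<in>U. \<eta> u = (\<lambda>u\<in>U. \<xi> s0 u) u)"
  proof (rule V.connecting_hom_eq_zero_imp_extends[OF assms(4) smooth_W _ _ _ _ split])
    fix u g c assume u: "u \<in> U"
    show "(\<lambda>u\<in>U. \<xi> s0 u) u \<in> carrier W" using u closed U by (simp add: \<xi>_U)
    show "(\<lambda>u\<in>U. \<xi> s0 u) (u \<oplus>\<^bsub>V\<^esub> u') = (\<lambda>u\<in>U. \<xi> s0 u) u \<oplus>\<^bsub>W\<^esub> (\<lambda>u\<in>U. \<xi> s0 u) u'" if "u' \<in> U" for u'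
      using u that U lin[of 0] V.S.a_closed by (simp add: \<xi>_U linear_map_def)
    show "(\<lambda>u\<in>U. \<xi> s0 u) (c \<odot>\<^bsub>V\<^esub> u) = c \<odot>\<^bsub>W\<^esub> (\<lambda>u\<in>U. \<xi> s0 u) u"
      using u U lin[of 0] V.sub_smult by (simp add: \<xi>_U linear_map_def)
    show "(\<lambda>u\<in>U. \<xi> s0 u) (act V g u) = act W g ((\<lambda>u\<in>U. \<xi> s0 u) u)" if "g \<in> carrier G"
      using u that V.sub_act by (simp add: \<xi>_U \<xi>_act)
  qed
  then obtain \<eta> where \<eta>: "intertwiner G V W \<eta>" "\<And>u. u \<in> U \<Longrightarrow> \<eta> u = \<xi>c 0 u"
    using \<xi>_U by auto
  have \<eta>_closed: "\<eta> v \<in> carrier W" if "v \<in> carrier V" for v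
    using intertwiner_closed[OF \<eta>(1) that] .

  let ?\<zeta> = "\<lambda>v. \<xi>c 0 v \<ominus>\<^bsub>W\<^esub> \<eta> v"
  have "linear_map V W ?\<zeta>"
    using lin[of 0] intertwiner_linear[OF \<eta>(1)]
    by (auto simp: linear_map_def Pi_iff a_minus_def W.V.M.minus_add W.V.M.a_ac
        W.V.smult_add_right W.V.smult_minus_right)
  moreover have "?\<zeta> u = \<zero>\<^bsub>W\<^esub>" if "u \<in> U" for u
    using that \<eta>(2) closed U W.V.diff_eq_0_iff by metis
  ultimately obtain h where h: "h \<in> extensional (carrier ?Q)" "linear_map ?Q W h"
      "\<And>v. v \<in> carrier V \<Longrightarrow> h (?p v) = ?\<zeta> v"
    using V.linear_map_descend[OF W.V.module_axioms] by blast
  then have h_Hom: "h \<in> carrier (Hom_rep G ?Q W)" by simp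
  have aug_h: "aug_prod (Hom_rep G ?Q W) hs h (?p v) = aug_fun G V W hs (\<xi>c 0) v"
    if hs: "set hs \<subseteq> carrier G" "hs \<noteq> []" and v: "v \<in> carrier V" for hs v
  proof -
    have "aug_prod (Hom_rep G ?Q W) hs h (?p v) = aug_fun G ?Q W hs h (?p v)"
      using QW.aug_prod_Hom_rep[OF h_Hom hs(1)] intertwiner_closed[OF V.intertwiner_coset v] by blast
    also have "\<dots> = aug_fun G V W hs (\<lambda>v. h (?p v)) v"
      by (rule aug_fun_pullback[OF group V.group_rep V.intertwiner_coset hs(1) v])
    also have "\<dots> = aug_fun G V W hs ?\<zeta> v"
      using h(3) hs(1) v by (rule VW.aug_fun_cong)
    also have "\<dots> = aug_fun G V W hs (\<xi>c 0) v \<ominus>\<^bsub>W\<^esub> aug_fun G V W hs \<eta> v"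
      using closed \<eta>_closed hs(1) v by (rule VW.aug_fun_diff)
    also have "\<dots> = aug_fun G V W hs (\<xi>c 0) v"
      using VW.aug_fun_intertwiner[OF \<eta>(1) hs v] VW.aug_fun_closed[of "\<xi>c 0", OF _ hs(1) v] closed
      by (simp add: a_minus_def)
    finally show ?thesis .
  qed

  \<comment> \<open>\<open>Hom_Gk G k0\<close> tests lists of length \<open>Suc k0\<close>; the
    matching coefficient has index -(k0 + 1), just below the pole.\<close>
  have "aug_prod (Hom_rep G ?Q W) hs h = \<zero>\<^bsub>Hom_rep G ?Q W\<^esub>"
    if hs: "length hs = Suc k0" "set hs \<subseteq> carrier G" for hs
  proof (rule extensionalityI[of _ "carrier ?Q"])
    show "aug_prod (Hom_rep G ?Q W) hs h \<in> extensional (carrier ?Q)"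
      using QW.aug_prod_Hom_rep[OF h_Hom hs(2)] by simp
    show "aug_prod (Hom_rep G ?Q W) hs h Z = \<zero>\<^bsub>Hom_rep G ?Q W\<^esub> Z" if Z: "Z \<in> carrier ?Q" for Z
    proof -
      obtain v where v: "v \<in> carrier V" "Z = ?p v" using Z by (rule V.coset_cases)
      moreover have "hs \<noteq> []" using hs(1) by auto
      moreover have "\<xi>c (- int (length hs)) v = \<zero>\<^bsub>W\<^esub>" using order hs(1) v(1) by simp
      ultimately show ?thesis
        using aug_h[of hs v] aug[of hs v] hs order v(1) Z by auto
    qed
  qed simp
  with h_Hom have "h \<in> Hom_Ginf G ?Q W"
    unfolding Hom_Ginf_def Hom_Gk_def by blast
  with assms(16) have zero: "aug_prod (Hom_rep G ?Q W) gs h = \<zero>\<^bsub>Hom_rep G ?Q W\<^esub>" by blast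
  obtain v where v: "v \<in> carrier V" "\<xi>c (- int k0) v \<noteq> \<zero>\<^bsub>W\<^esub>" using pole by blast
  \<comment> \<open>An empty product would not remove \<eta> from \<open>h\<close>.\<close>
  have "gs \<noteq> []" using assms(12,13) by auto
  then have "(\<Prod>g\<leftarrow>gs. deriv (\<lambda>s. \<omega> s g) s0) \<odot>\<^bsub>W\<^esub> \<xi>c (- int k0) v = aug_prod (Hom_rep G ?Q W) gs h (?p v)"
    using aug_h[of gs v] aug[of gs v] assms(12-14) order v(1) by auto
  also have "\<dots> = \<zero>\<^bsub>W\<^esub>"
    using intertwiner_closed[OF V.intertwiner_coset v(1)] by (simp add: zero)
  \<comment> \<open>The vector \<open>v\<close> was chosen with nonzero leading coefficient, so the
    scalar must vanish, whereas none of its factors does.\<close>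
  finally have "(\<Prod>g\<leftarrow>gs. deriv (\<lambda>s. \<omega> s g) s0) = 0"
    using W.V.smult_eq_0_iff closed v by blast
  with assms(15) show False by (auto simp: prod_list_zero_iff)
qed

end
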